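(* Any simple compact real Lie algebra $\mathfrak{g}$ has a principal three-dimensional subalgebra.
   Context: In a complex semisimple Lie algebra $\mathfrak{g}$, an $\mathfrak{sl}_2$-triple is a triple $\{e,h,f\}$ with $[h,e]=2e$, $[h,f]=-2f$, $[e,f]=h$. A nilpotent element $e$ is principal if its centralizer $\{z\in\mathfrak{g}:[z,e]=0\}$ has dimension equal to $\mathrm{rank}\,\mathfrak{g}$. A principal subalgebra of $\mathfrak{g}$ is the span of an $\mathfrak{sl}_2$-triple $\{e,h,f\}$ with $e$ a principal nilpotent. A three-dimensional simple subalgebra of a simple compact real Lie algebra $\mathfrak{g}$ is called principal if its complexification is a principal subalgebra of $\mathfrak{g}\otimes_{\mathbb{R}}\mathbb{C}$. *)

theory Defs
  imports Complex_Main "HOL-Library.Product_Plus"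
begin

definition (in vector_space) finite_dim :: bool where
  "finite_dim \<longleftrightarrow> (\<exists>B. finite B \<and> span B = UNIV)"

text \<open>\<open>extend_basis {}\<close> is some basis of the whole space; on a finite-dimensional space the trace
  of a linear map does not depend on this choice.\<close>

definition (in vector_space) operator_trace :: "('b \<Rightarrow> 'b) \<Rightarrow> 'a" where
  "operator_trace f = (let B = extend_basis {} in \<Sum>b\<in>B. representation B (f b) b)"

definition (in vector_space) diagonalizable :: "('b \<Rightarrow> 'b) \<Rightarrow> bool" where
  "diagonalizable f \<longleftrightarrow> span {v. \<exists>c. f v = scale c v} = UNIV"

locale lie_algebra = vector_space scale
  for scale :: "'f::field \<Rightarrow> 'a::ab_group_add \<Rightarrow> 'a" +
  fixes bracket :: "'a \<Rightarrow> 'a \<Rightarrow> 'a"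
  assumes bracket_add_left: "bracket (x + y) z = bracket x z + bracket y z"
    and bracket_add_right: "bracket x (y + z) = bracket x y + bracket x z"
    and bracket_scale_left: "bracket (scale c x) y = scale c (bracket x y)"
    and bracket_scale_right: "bracket x (scale c y) = scale c (bracket x y)"
    and bracket_self: "bracket x x = 0"
    and jacobi: "bracket x (bracket y z) + bracket y (bracket z x) + bracket z (bracket x y) = 0"
begin

definition lie_subalgebra :: "'a set \<Rightarrow> bool" where
  "lie_subalgebra S \<longleftrightarrow> subspace S \<and> (\<forall>x\<in>S. \<forall>y\<in>S. bracket x y \<in> S)"

definition lie_ideal_of :: "'a set \<Rightarrow> 'a set \<Rightarrow> bool" where
  "lie_ideal_of I S \<longleftrightarrow> subspace I \<and> I \<subseteq> S \<and> (\<forall>x\<in>S. \<forall>y\<in>I. bracket x y \<in> I)"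

text \<open>The subalgebra \<open>S\<close> is simple as a Lie algebra in its own right; for \<open>S = UNIV\<close> this is
  simplicity of the whole Lie algebra.\<close>

definition simple_subalgebra :: "'a set \<Rightarrow> bool" where
  "simple_subalgebra S \<longleftrightarrow> lie_subalgebra S \<and> (\<exists>x\<in>S. \<exists>y\<in>S. bracket x y \<noteq> 0) \<and>
     (\<forall>I. lie_ideal_of I S \<longrightarrow> I = {0} \<or> I = S)"

definition killing_form :: "'a \<Rightarrow> 'a \<Rightarrow> 'f" where
  "killing_form x y = operator_trace (\<lambda>z. bracket x (bracket y z))"

definition centralizer :: "'a \<Rightarrow> 'a set" where
  "centralizer e = {z. bracket z e = 0}"

text \<open>Cartan subalgebras of a semisimple Lie algebra over an algebraically closed field of
  characteristic 0: maximal abelian subalgebras that act diagonalizably in the adjoint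
  representation. In that setting they exist and all have the same dimension, the rank.\<close>

definition cartan_subalgebra :: "'a set \<Rightarrow> bool" where
  "cartan_subalgebra H \<longleftrightarrow> subspace H \<and> (\<forall>x\<in>H. \<forall>y\<in>H. bracket x y = 0) \<and>
     (\<forall>x. (\<forall>y\<in>H. bracket x y = 0) \<longrightarrow> x \<in> H) \<and>
     (\<forall>x\<in>H. diagonalizable (bracket x))"

definition lie_rank :: nat where
  "lie_rank = dim (SOME H. cartan_subalgebra H)"

definition sl2_triple :: "'a \<Rightarrow> 'a \<Rightarrow> 'a \<Rightarrow> bool" where
  "sl2_triple e h f \<longleftrightarrow> bracket h e = scale 2 e \<and> bracket h f = scale (-2) f \<and> bracket e f = h"

definition nilpotent_element :: "'a \<Rightarrow> bool" where
  "nilpotent_element e \<longleftrightarrow> (\<exists>n. \<forall>x. (bracket e ^^ n) x = 0)"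

definition principal_nilpotent :: "'a \<Rightarrow> bool" where
  "principal_nilpotent e \<longleftrightarrow> nilpotent_element e \<and> dim (centralizer e) = lie_rank"

definition principal_subalgebra :: "'a set \<Rightarrow> bool" where
  "principal_subalgebra S \<longleftrightarrow>
     (\<exists>e h f. sl2_triple e h f \<and> principal_nilpotent e \<and> S = span {e, h, f})"

end

locale real_lie_algebra = lie_algebra scale bracket
  for scale :: "real \<Rightarrow> 'a::ab_group_add \<Rightarrow> 'a" and bracket :: "'a \<Rightarrow> 'a \<Rightarrow> 'a"
begin

text \<open>For a simple (more generally, semisimple) real Lie algebra, being the Lie algebra of a compact
  group means having a negative definite Killing form.\<close>

definition compact_type :: bool where
  "compact_type \<longleftrightarrow> (\<forall>x. x \<noteq> 0 \<longrightarrow> killing_form x x < 0)"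

text \<open>The complexification is modelled on pairs, \<open>(x, y)\<close> standing for
  \<open>x \<otimes> 1 + y \<otimes> \<i>\<close>. The complexification of a real subspace \<open>S\<close> is then \<open>S \<times> S\<close>.\<close>

definition complex_scale :: "complex \<Rightarrow> 'a \<times> 'a \<Rightarrow> 'a \<times> 'a" where
  "complex_scale c p =
     (scale (Re c) (fst p) - scale (Im c) (snd p), scale (Re c) (snd p) + scale (Im c) (fst p))"

definition complex_bracket :: "'a \<times> 'a \<Rightarrow> 'a \<times> 'a \<Rightarrow> 'a \<times> 'a" where
  "complex_bracket p q =
     (bracket (fst p) (fst q) - bracket (snd p) (snd q),
      bracket (fst p) (snd q) + bracket (snd p) (fst q))"

lemma bracket_diff_left: "bracket (x - y) z = bracket x z - bracket y z"
  using bracket_add_left[of "x - y" y z] by (simp add: algebra_simps)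

lemma bracket_diff_right: "bracket x (y - z) = bracket x y - bracket x z"
  using bracket_add_right[of x "y - z" z] by (simp add: algebra_simps)

lemma bracket_swap: "bracket x y = - bracket y x"
proof -
  have "bracket (x + y) (x + y) = bracket x y + bracket y x"
    by (simp only: bracket_add_left, simp add: bracket_add_right bracket_self)
  then show ?thesis
    by (simp add: bracket_self eq_neg_iff_add_eq_0)
qed

lemma jacobi': "bracket x (bracket y z) = - bracket y (bracket z x) - bracket z (bracket x y)"
  using jacobi[of x y z] by (simp add: algebra_simps eq_neg_iff_add_eq_0)

sublocale complexification: lie_algebra complex_scale complex_bracket
proof
  fix x y z :: "'a \<times> 'a" and a b :: complex
  show "complex_scale a (x + y) = complex_scale a x + complex_scale a y"
    by (simp add: complex_scale_def prod_eq_iff algebra_simps)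
  show "complex_scale (a + b) x = complex_scale a x + complex_scale b x"
    by (simp add: complex_scale_def prod_eq_iff algebra_simps)
  show "complex_scale a (complex_scale b x) = complex_scale (a * b) x"
    by (simp add: complex_scale_def prod_eq_iff algebra_simps)
  show "complex_scale 1 x = x"
    by (simp add: complex_scale_def prod_eq_iff)
  show "complex_bracket (x + y) z = complex_bracket x z + complex_bracket y z"
    by (simp add: complex_bracket_def prod_eq_iff bracket_add_left algebra_simps)
  show "complex_bracket x (y + z) = complex_bracket x y + complex_bracket x z"
    by (simp add: complex_bracket_def prod_eq_iff bracket_add_right algebra_simps)
  show "complex_bracket (complex_scale a x) y = complex_scale a (complex_bracket x y)"
    by (simp add: complex_bracket_def complex_scale_def prod_eq_iff bracket_add_left
        bracket_diff_left bracket_scale_left algebra_simps)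
  show "complex_bracket x (complex_scale a y) = complex_scale a (complex_bracket x y)"
    by (simp add: complex_bracket_def complex_scale_def prod_eq_iff bracket_add_right
        bracket_diff_right bracket_scale_right algebra_simps)
  show "complex_bracket x x = 0"
    using bracket_swap[of "fst x" "snd x"]
    by (simp add: complex_bracket_def prod_eq_iff bracket_self)
  have J: "bracket p (bracket q r) = - bracket q (bracket r p) - bracket r (bracket p q)" for p q r
    by (rule jacobi')
  show "complex_bracket x (complex_bracket y z) + complex_bracket y (complex_bracket z x)
      + complex_bracket z (complex_bracket x y) = 0"
    using J[of "fst x" "fst y" "fst z"] J[of "fst x" "snd y" "snd z"]
      J[of "snd x" "fst y" "snd z"] J[of "snd x" "snd y" "fst z"]
      J[of "snd x" "snd y" "snd z"] J[of "snd x" "fst y" "fst z"]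
      J[of "fst x" "snd y" "fst z"] J[of "fst x" "fst y" "snd z"]
    by (simp add: complex_bracket_def prod_eq_iff bracket_add_right bracket_diff_right)
qed

definition principal_three_dim_subalgebra :: "'a set \<Rightarrow> bool" where
  "principal_three_dim_subalgebra S \<longleftrightarrow>
     simple_subalgebra S \<and> dim S = 3 \<and> complexification.principal_subalgebra (S \<times> S)"

end

end

theory Submission
  imports Defs "HOL-Computational_Algebra.Fundamental_Theorem_Algebra"
begin

text \<open>Let \<open>\<sigma>\<close> be the conjugation of the complexification. Then \<open>- \<kappa>(x, \<sigma> y)\<close> is a positive definite
  Hermitian form for which the adjoint of \<open>ad x\<close> is \<open>- ad (\<sigma> x)\<close>; so \<open>ad a\<close> is diagonalizable with
  real eigenvalues whenever \<open>\<sigma> a = - a\<close>, and a maximal commuting set \<open>A\<close> of such elements yields a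
  Cartan subalgebra and roots. Unit root vectors \<open>v\<^sub>r\<close> of the simple roots satisfy
  \<open>[v\<^sub>r, \<sigma> v\<^sub>s] = 0\<close> for \<open>r \<noteq> s\<close>, and the elements \<open>t\<^sub>r = [v\<^sub>r, - \<sigma> v\<^sub>r]\<close> of \<open>A\<close> form pairwise obtuse angles
  in an open half space. Hence there is \<open>h = \<Sum>\<^sub>r c\<^sub>r t\<^sub>r\<close> with \<open>c\<^sub>r \<ge> 0\<close> on which all simple roots
  take the value 2. With \<open>e = \<Sum>\<^sub>r \<surd>c\<^sub>r v\<^sub>r\<close> and \<open>f = - \<sigma> e\<close> this gives an \<open>sl\<^sub>2\<close>-triple stable under \<open>\<sigma>\<close>
  whose real points are the required subalgebra. Every root takes a nonzero even value on \<open>h\<close>, so the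
  centralizer of \<open>e\<close> is no larger than that of \<open>h\<close>, which is the Cartan subalgebra. In the other
  direction, every centralizer is at least as large as every Cartan subalgebra, so in particular all
  Cartan subalgebras have the same dimension.\<close>

section \<open>Eigenspaces, independence and traces\<close>

text \<open>The rank is the dimension of an unspecified Cartan subalgebra, and being principal asks
  for equality with it. So a Cartan subalgebra built by hand is of use only once all of them have
  the same dimension. The bound \<open>dim H <= dim (centralizer x)\<close>, valid for every
  \<open>x\<close>, serves twice: it is the missing half of the equality for \<open>e\<close>, and,
  for an \<open>x\<close> whose centralizer is another Cartan subalgebra, it gives the uniqueness of
  the dimension. A root is handled through the vector of \<open>A\<close> that represents it, and
  simple means not a sum of two positive roots. This yields the vanishing brackets and hence the
  obtuse angles, and it makes every positive root a sum of simple ones, so the value 2 on the simple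
  roots, forced by \<open>[h, e] = 2 e\<close>, becomes a positive even value on all positive roots.
  The signs of the coefficients are the crux: since they are nonnegative, their square roots are
  real, so conjugating \<open>e\<close> only conjugates the root vectors, and
  \<open>[e, - conj e]\<close> is exactly the prescribed combination.\<close>

definition (in vector_space) eigenspace :: "('b \<Rightarrow> 'b) \<Rightarrow> 'a \<Rightarrow> 'b set" where
  "eigenspace f c = {v. f v = scale c v}"

definition (in vector_space) spectrum :: "('b \<Rightarrow> 'b) \<Rightarrow> 'a set" where
  "spectrum f = {c. \<exists>v\<in>eigenspace f c. v \<noteq> 0}"

text \<open>Indexed families instead of sets: vectors depending on a parameter may coincide for some
  values, and a repetition has to count as a dependence.\<close>

definition (in vector_space) independent_family :: "'i set \<Rightarrow> ('i \<Rightarrow> 'b) \<Rightarrow> bool" where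
  "independent_family I v \<longleftrightarrow> (\<forall>a. (\<Sum>i\<in>I. scale (a i) (v i)) = 0 \<longrightarrow> (\<forall>i\<in>I. a i = 0))"

context vector_space
begin

interpretation endo: vector_space_pair scale scale ..

lemma subspace_eigenspace:
  assumes "Vector_Spaces.linear scale scale f"
  shows "subspace (eigenspace f c)"
  unfolding subspace_def eigenspace_def
  using assms
  by (auto simp: endo.linear_0 endo.linear_add endo.linear_scale scale_right_distrib
      scale_left_commute)

text \<open>Applying \<open>f - d\<close> to the sum removes the component for \<open>d\<close> and
  multiplies every other one by the nonzero factor \<open>x - d\<close>, so induction on the set of
  eigenvalues applies. With \<open>W = {0}\<close> this is independence of eigenvectors; with
  \<open>W\<close> an eigenspace of a commuting operator it leads to simultaneous
  diagonalization.\<close>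

lemma eigen_component_mem:
  assumes f: "Vector_Spaces.linear scale scale f"
    and W: "subspace W" "\<And>v. v \<in> W \<Longrightarrow> f v \<in> W"
    and "finite \<Lambda>" "\<And>c. c \<in> \<Lambda> \<Longrightarrow> u c \<in> eigenspace f c"
    and "(\<Sum>c\<in>\<Lambda>. u c) \<in> W" "c \<in> \<Lambda>"
  shows "u c \<in> W"
  using assms(4-)
proof (induction \<Lambda> arbitrary: u c rule: finite_induct)
  case empty
  then show ?case by simp
next
  case (insert d \<Lambda>)
  let ?s = "\<Sum>c\<in>insert d \<Lambda>. u c"
  have fu: "f (u x) = scale x (u x)" if "x \<in> insert d \<Lambda>" for x
    using insert.prems(1)[OF that] by (simp add: eigenspace_def)
  have "f ?s - scale d ?s = (\<Sum>x\<in>insert d \<Lambda>. scale x (u x) - scale d (u x))"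
    unfolding endo.linear_sum[OF f] scale_sum_right sum_subtractf[symmetric]
    by (rule sum.cong) (use fu in auto)
  also have "\<dots> = (\<Sum>x\<in>\<Lambda>. scale (x - d) (u x))"
    using insert.hyps by (simp add: scale_left_diff_distrib)
  finally have "(\<Sum>x\<in>\<Lambda>. scale (x - d) (u x)) \<in> W"
    using W insert.prems(2) by (metis subspace_diff subspace_scale)
  moreover have "scale (x - d) (u x) \<in> eigenspace f x" if "x \<in> \<Lambda>" for x
    using fu[of x] that by (simp add: eigenspace_def endo.linear_scale[OF f] mult.commute)
  ultimately have *: "scale (x - d) (u x) \<in> W" if "x \<in> \<Lambda>" for x
    using insert.IH[of "\<lambda>x. scale (x - d) (u x)"] that by blast
  have **: "u x \<in> W" if "x \<in> \<Lambda>" for x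
  proof -
    have "x - d \<noteq> 0" using that insert.hyps by auto
    then show ?thesis
      using subspace_scale[OF W(1) *[OF that], of "inverse (x - d)"] by simp
  qed
  have "(\<Sum>c\<in>\<Lambda>. u c) \<in> W" by (rule subspace_sum[OF W(1) **])
  with insert.prems(2) insert.hyps have "u d \<in> W"
    using subspace_diff[OF W(1)] by fastforce
  with ** insert.prems(3) show ?case by blast
qed

lemma span_eigenvectors_decompose:
  assumes f: "Vector_Spaces.linear scale scale f"
    and "v \<in> span (\<Union>c\<in>J. eigenspace f c)"
  obtains \<Lambda> u where "finite \<Lambda>" "\<Lambda> \<subseteq> J" "\<And>c. c \<in> \<Lambda> \<Longrightarrow> u c \<in> eigenspace f c" "v = (\<Sum>c\<in>\<Lambda>. u c)"
proof -
  have "\<exists>\<Lambda> u. finite \<Lambda> \<and> \<Lambda> \<subseteq> J \<and> (\<forall>c. u c \<in> eigenspace f c) \<and> v = (\<Sum>c\<in>\<Lambda>. u c)"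
    using assms(2)
  proof (induction rule: span_induct_alt)
    case base
    show ?case
      by (rule exI[of _ "{}"]) (auto intro!: exI[of _ "\<lambda>_. 0"] simp: eigenspace_def endo.linear_0[OF f])
  next
    case (step a x y)
    then obtain \<Lambda> u d where *: "finite \<Lambda>" "\<Lambda> \<subseteq> J" "\<forall>c. u c \<in> eigenspace f c" "y = (\<Sum>c\<in>\<Lambda>. u c)"
      and d: "d \<in> J" "x \<in> eigenspace f d" by blast
    let ?\<Lambda> = "insert d \<Lambda>"
    \<comment> \<open>The two tests treat \<open>d\<close> inside and outside the old index set at
      once; a value of \<open>u\<close> outside that set must not be counted.\<close>
    let ?u = "\<lambda>c. (if c = d then scale a x else 0) + (if c \<in> \<Lambda> then u c else 0)"
    have "?u c \<in> eigenspace f c" for c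
      using * d subspace_eigenspace[OF f, of c]
      by (intro subspace_add) (auto intro: subspace_scale simp: subspace_0)
    moreover have "scale a x + y = (\<Sum>c\<in>?\<Lambda>. ?u c)"
    proof -
      have "(\<Sum>c\<in>?\<Lambda>. ?u c) = (\<Sum>c\<in>?\<Lambda>. if c = d then scale a x else 0) + (\<Sum>c\<in>?\<Lambda>. if c \<in> \<Lambda> then u c else 0)"
        by (simp only: sum.distrib)
      also have "(\<Sum>c\<in>?\<Lambda>. if c = d then scale a x else 0) = scale a x"
        using *(1) by (simp only: sum.delta finite_insert) simp
      also have "(\<Sum>c\<in>?\<Lambda>. if c \<in> \<Lambda> then u c else 0) = (\<Sum>c\<in>\<Lambda>. u c)"
        using *(1) by (intro sum.mono_neutral_cong_right) auto
      finally show ?thesis using * by simp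
    qed
    ultimately show ?case
      using * d by (intro exI[of _ ?\<Lambda>] exI[of _ ?u]) auto
  qed
  then show ?thesis using that by blast
qed

lemma diagonalizable_iff:
  "diagonalizable f \<longleftrightarrow> span (\<Union>c. eigenspace f c) = UNIV"
  unfolding diagonalizable_def eigenspace_def by (rule arg_cong[of _ _ "\<lambda>S. span S = UNIV"]) auto

text \<open>Expresses that diagonalizability passes to invariant subspaces, since the
  eigencomponents of a vector of \<open>W\<close> stay in \<open>W\<close>.\<close>

lemma diagonalizable_decompose:
  assumes f: "Vector_Spaces.linear scale scale f" and W: "subspace W" "\<And>v. v \<in> W \<Longrightarrow> f v \<in> W"
    and "diagonalizable f" "v \<in> W"
  obtains \<Lambda> u where "finite \<Lambda>" "\<And>c. c \<in> \<Lambda> \<Longrightarrow> u c \<in> eigenspace f c"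
    "\<And>c. c \<in> \<Lambda> \<Longrightarrow> u c \<in> W" "v = (\<Sum>c\<in>\<Lambda>. u c)"
proof -
  have "v \<in> span (\<Union>c\<in>UNIV. eigenspace f c)" using assms(4) by (simp add: diagonalizable_iff)
  from span_eigenvectors_decompose[OF f this] obtain \<Lambda> u
    where *: "finite \<Lambda>" "\<And>c. c \<in> \<Lambda> \<Longrightarrow> u c \<in> eigenspace f c" "v = (\<Sum>c\<in>\<Lambda>. u c)" by metis
  then show ?thesis
    using that[of \<Lambda> u] eigen_component_mem[OF f W *(1,2)] assms(5) by blast
qed

lemma independent_family_image:
  assumes "independent_family I v" "finite I"
  shows "inj_on v I" "independent (v ` I)"
proof -
  show inj: "inj_on v I"
  proof (rule inj_onI, rule ccontr)
    fix i j assume ij: "i \<in> I" "j \<in> I" "v i = v j" "i \<noteq> j"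
    let ?a = "\<lambda>k. if k = i then 1 else if k = j then -1 else (0::'a)"
    have "(\<Sum>k\<in>I. scale (?a k) (v k)) = (\<Sum>k\<in>{i,j}. scale (?a k) (v k))"
      using ij assms(2) by (intro sum.mono_neutral_right) auto
    also have "\<dots> = 0" using ij by simp
    finally have "?a i = 0"
      using assms(1)[unfolded independent_family_def, rule_format, of ?a i] ij(1) by blast
    then show False by simp
  qed
  show "independent (v ` I)"
  proof (rule independent_if_scalars_zero)
    fix g x assume g: "(\<Sum>x\<in>v ` I. scale (g x) x) = 0" and x: "x \<in> v ` I"
    from g have "(\<Sum>i\<in>I. scale (g (v i)) (v i)) = 0" by (simp add: sum.reindex[OF inj])
    then show "g x = 0" using assms(1) x by (auto simp: independent_family_def)
  qed (use assms in simp)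
qed

lemma independent_family_id:
  assumes "independent B" "finite B"
  shows "independent_family B (\<lambda>b. b)"
  unfolding independent_family_def using independentD[OF assms order.refl] by blast

lemma independent_family_eigenvectors:
  assumes f: "Vector_Spaces.linear scale scale f" and "finite \<Lambda>"
    "\<And>c. c \<in> \<Lambda> \<Longrightarrow> u c \<in> eigenspace f c" "\<And>c. c \<in> \<Lambda> \<Longrightarrow> u c \<noteq> 0"
  shows "independent_family \<Lambda> u"
  unfolding independent_family_def
proof (intro allI impI ballI)
  fix a c assume "(\<Sum>c\<in>\<Lambda>. scale (a c) (u c)) = 0" "c \<in> \<Lambda>"
  then have "scale (a c) (u c) \<in> {0}"
    using assms(2,3) subspace_scale[OF subspace_eigenspace[OF f]]
    by (intro eigen_component_mem[OF f, of "{0}" \<Lambda> "\<lambda>c. scale (a c) (u c)"])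
      (auto simp: endo.linear_0[OF f])
  then show "a c = 0" using assms(4) \<open>c \<in> \<Lambda>\<close> by simp
qed

lemma independent_Un:
  assumes "finite C" "independent B" "independent C" "span B \<inter> span C \<subseteq> {0}"
  shows "independent (B \<union> C)"
  using assms
proof (induction C rule: finite_induct)
  case empty
  then show ?case by simp
next
  case (insert c C)
  have "independent C" "c \<notin> span C"
    using insert.prems(2) insert.hyps by (auto simp: independent_insert)
  have "span C \<subseteq> span (insert c C)" by (rule span_mono) auto
  then have "independent (B \<union> C)"
    using insert.IH[OF insert.prems(1) \<open>independent C\<close>] insert.prems(3) by blast
  moreover have "c \<notin> span (B \<union> C)"
  proof
    assume "c \<in> span (B \<union> C)"
    then obtain x y where xy: "x \<in> span B" "y \<in> span C" "c = x + y"
      unfolding span_Un by auto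
    then have "x = c - y" by simp
    then have "x \<in> span (insert c C)"
      using xy(2) \<open>span C \<subseteq> span (insert c C)\<close> by (auto intro: span_diff span_base)
    then have "x = 0" using xy(1) insert.prems(3) by blast
    then show False using xy \<open>c \<notin> span C\<close> by simp
  qed
  ultimately show ?case by (simp add: independent_insert)
qed

end

section \<open>Dimension counts, finiteness of the spectrum, and traces\<close>

context finite_dimensional_vector_space
begin

interpretation endo: vector_space_pair scale scale ..

lemma dim_add_le:
  assumes "subspace U" "subspace W" "U \<inter> W \<subseteq> {0}" "U \<subseteq> X" "W \<subseteq> X"
  shows "dim U + dim W \<le> dim X"
proof -
  obtain B C where B: "B \<subseteq> U" "independent B" "U \<subseteq> span B" "card B = dim U"
    and C: "C \<subseteq> W" "independent C" "W \<subseteq> span C" "card C = dim W"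
    using basis_exists[of U] basis_exists[of W] by metis
  have fin: "finite B" "finite C" using B C finiteI_independent by auto
  have sp: "span B = U" "span C = W" using B C assms(1,2) by (simp_all add: span_subspace)
  have ind: "independent (B \<union> C)" using independent_Un[OF fin(2) B(2) C(2)] sp assms(3) by simp
  have "B \<inter> C = {}"
  proof -
    have "B \<inter> C \<subseteq> {0}" using B C assms(3) by auto
    moreover have "0 \<notin> B" using B(2) dependent_zero by blast
    ultimately show ?thesis by blast
  qed
  then have "card (B \<union> C) = dim U + dim W" using fin B C by (simp add: card_Un_disjoint)
  moreover have "B \<union> C \<subseteq> X" using B C assms by auto
  ultimately show ?thesis using independent_card_le_dim[OF _ ind] by metis
qed

lemma dim_span_Un_le: "dim (span (U \<union> W)) \<le> dim U + dim W"
proof -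
  obtain B C where B: "B \<subseteq> U" "independent B" "U \<subseteq> span B" "card B = dim U"
    and C: "C \<subseteq> W" "independent C" "W \<subseteq> span C" "card C = dim W"
    using basis_exists[of U] basis_exists[of W] by metis
  have fin: "finite B" "finite C" using B C finiteI_independent by auto
  have "U \<union> W \<subseteq> span (B \<union> C)"
    using B(3) C(3) span_mono[of B "B \<union> C"] span_mono[of C "B \<union> C"] by blast
  then have "dim (U \<union> W) \<le> card (B \<union> C)" using fin by (intro dim_le_card) auto
  also have "\<dots> \<le> dim U + dim W" using card_Un_le[of B C] B C by simp
  finally show ?thesis by simp
qed

lemma independent_family_card_le_dim:
  assumes "independent_family I v" "finite I" "v ` I \<subseteq> X"
  shows "card I \<le> dim X"
  using independent_card_le_dim[OF assms(3) independent_family_image(2)[OF assms(1,2)]]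
    independent_family_image(1)[OF assms(1,2)] by (simp add: card_image)

lemma finite_spectrum:
  assumes f: "Vector_Spaces.linear scale scale f"
  shows "finite (spectrum f)"
proof -
  have "\<forall>c. \<exists>v. c \<in> spectrum f \<longrightarrow> v \<in> eigenspace f c \<and> v \<noteq> 0" by (auto simp: spectrum_def)
  then obtain u where u: "\<And>c. c \<in> spectrum f \<Longrightarrow> u c \<in> eigenspace f c \<and> u c \<noteq> 0" by metis
  have "card \<Lambda> \<le> dim UNIV" if "\<Lambda> \<subseteq> spectrum f" "finite \<Lambda>" for \<Lambda>
    using that u by (intro independent_family_card_le_dim[of \<Lambda> u]
        independent_family_eigenvectors[OF f]) auto
  then show ?thesis using finite_if_finite_subsets_card_bdd by metis
qed

lemma card_spectrum_le:
  assumes f: "Vector_Spaces.linear scale scale f"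
  shows "card (spectrum f) \<le> dim UNIV"
proof -
  have "\<forall>c. \<exists>v. c \<in> spectrum f \<longrightarrow> v \<in> eigenspace f c \<and> v \<noteq> 0" by (auto simp: spectrum_def)
  then obtain u where u: "\<And>c. c \<in> spectrum f \<Longrightarrow> u c \<in> eigenspace f c \<and> u c \<noteq> 0" by metis
  then show ?thesis using finite_spectrum[OF f]
    by (intro independent_family_card_le_dim[of _ u] independent_family_eigenvectors[OF f]) auto
qed

text \<open>Both sides are the same double sum over the matrix entries of \<open>G\<close> from
  \<open>B\<close> to \<open>C\<close> and of \<open>F\<close> from \<open>C\<close> to
  \<open>B\<close>. Two bases are allowed so that \<open>G = id\<close> gives independence of the
  basis, and \<open>B = C\<close> gives cyclicity of the trace.\<close>

lemma trace_comp_swap: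
  assumes F: "Vector_Spaces.linear scale scale F" and G: "Vector_Spaces.linear scale scale G"
    and B: "independent B" "span B = UNIV" and C: "independent C" "span C = UNIV"
  shows "(\<Sum>b\<in>B. representation B (F (G b)) b) = (\<Sum>c\<in>C. representation C (G (F c)) c)"
proof -
  have fin: "finite B" "finite C" using B C finiteI_independent by auto
  have "representation B (F (G b)) b = (\<Sum>c\<in>C. representation C (G b) c * representation B (F c) b)"
    if "b \<in> B" for b
  proof -
    have "G b = (\<Sum>c\<in>C. scale (representation C (G b) c) c)"
      using C fin by (simp add: sum_representation_eq)
    then have "F (G b) = (\<Sum>c\<in>C. scale (representation C (G b) c) (F c))"
      using endo.linear_sum[OF F] endo.linear_scale[OF F] by (metis (no_types, lifting) sum.cong)
    then show ?thesis using B by (simp add: representation_sum representation_scale)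
  qed
  moreover have "representation C (G (F c)) c = (\<Sum>b\<in>B. representation C (G b) c * representation B (F c) b)"
    if "c \<in> C" for c
  proof -
    have "F c = (\<Sum>b\<in>B. scale (representation B (F c) b) b)"
      using B fin by (simp add: sum_representation_eq)
    then have "G (F c) = (\<Sum>b\<in>B. scale (representation B (F c) b) (G b))"
      using endo.linear_sum[OF G] endo.linear_scale[OF G] by (metis (no_types, lifting) sum.cong)
    then show ?thesis using C by (simp add: representation_sum representation_scale mult.commute)
  qed
  ultimately show ?thesis by (simp add: sum.swap[of _ C B])
qed

lemma operator_trace_basis:
  assumes F: "Vector_Spaces.linear scale scale F" and B: "independent B" "span B = UNIV"
  shows "operator_trace F = (\<Sum>b\<in>B. representation B (F b) b)"
proof -
  have E: "independent (extend_basis {})" "span (extend_basis {}) = UNIV"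
    by (rule independent_extend_basis[OF independent_empty], rule span_extend_basis[OF independent_empty])
  show ?thesis
    unfolding operator_trace_def Let_def
    using trace_comp_swap[OF F linear_id E B] by (simp add: id_def)
qed

end

section \<open>Separating operators and polynomial curves\<close>

text \<open>Two distinct pairs collide for at most one \<open>n\<close>, because the condition is
  linear in \<open>n\<close>. The pairs will be joint eigenvalues of commuting operators
  \<open>f\<close> and \<open>g\<close>, and the map gives the eigenvalues of
  \<open>f + n g\<close>.\<close>

lemma finite_collisions:
  fixes S :: "('k::field_char_0 \<times> 'k) set"
  assumes "finite S"
  shows "finite {n::nat. \<not> inj_on (\<lambda>(c, d). c + of_nat n * d) S}"
proof -
  have *: "finite {n::nat. fst p + of_nat n * snd p = fst q + of_nat n * snd q}" if "p \<noteq> q"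
    for p q :: "'k \<times> 'k"
  proof (cases "snd p = snd q")
    case True
    then show ?thesis using that by (cases p; cases q) auto
  next
    case False
    have "{n::nat. fst p + of_nat n * snd p = fst q + of_nat n * snd q}
      \<subseteq> {n. (of_nat n :: 'k) = (fst q - fst p) / (snd p - snd q)}"
      using False by (auto simp: field_simps)
    moreover have "finite {n. (of_nat n :: 'k) = x}" for x
    proof (cases "\<exists>m. of_nat m = x")
      case True
      then obtain m where "of_nat m = x" by blast
      then have "{n. (of_nat n :: 'k) = x} = {m}" by auto
      then show ?thesis by simp
    qed auto
    ultimately show ?thesis using finite_subset by blast
  qed
  have "{n::nat. \<not> inj_on (\<lambda>(c, d). c + of_nat n * d) S} \<subseteq>
      (\<Union>p\<in>S. \<Union>q\<in>S - {p}. {n. fst p + of_nat n * snd p = fst q + of_nat n * snd q})"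
    by (force simp: inj_on_def)
  moreover have "finite \<dots>" by (intro finite_UN_I finite_Diff assms, rule *) auto
  ultimately show ?thesis using finite_subset by blast
qed

text \<open>Curves with polynomial coordinates, described without a basis; the induction rule then
  gives stability under linear maps, and polynomial functions under functionals.\<close>

inductive (in vector_space) poly_curve :: "('a \<Rightarrow> 'b) \<Rightarrow> bool" where
  monom: "poly_curve (\<lambda>t. scale (poly p t) v)"
| add: "poly_curve f \<Longrightarrow> poly_curve g \<Longrightarrow> poly_curve (\<lambda>t. f t + g t)"

context vector_space
begin

interpretation endo: vector_space_pair scale scale ..

lemma poly_curve_const: "poly_curve (\<lambda>t. v)"
  using poly_curve.monom[of 1 v] by simp

lemma poly_curve_scale: "poly_curve f \<Longrightarrow> poly_curve (\<lambda>t. scale (poly q t) (f t))"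
proof (induction rule: poly_curve.induct)
  case (monom p v)
  then show ?case using poly_curve.monom[of "q * p" v] by simp
next
  case (add f g)
  then show ?case using poly_curve.add by (simp add: scale_right_distrib)
qed

lemma poly_curve_linear:
  assumes F: "Vector_Spaces.linear scale scale F"
  shows "poly_curve f \<Longrightarrow> poly_curve (\<lambda>t. F (f t))"
proof (induction rule: poly_curve.induct)
  case (monom p v)
  then show ?case using poly_curve.monom[of p "F v"] by (simp add: endo.linear_scale[OF F])
next
  case (add f g)
  then show ?case using poly_curve.add by (simp add: endo.linear_add[OF F])
qed

lemma poly_curve_functional:
  assumes F: "Vector_Spaces.linear scale (*) F"
  shows "poly_curve f \<Longrightarrow> \<exists>p. \<forall>t. F (f t) = poly p t"
proof (induction rule: poly_curve.induct)
  case (monom p v)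
  interpret F: Vector_Spaces.linear scale "(*)" F by (rule F)
  show ?case by (rule exI[of _ "smult (F v) p"]) (simp add: F.scale mult.commute)
next
  case (add f g)
  interpret F: Vector_Spaces.linear scale "(*)" F by (rule F)
  from add.IH obtain p q where "\<forall>t. F (f t) = poly p t" "\<forall>t. F (g t) = poly q t" by blast
  then show ?case by (intro exI[of _ "p + q"]) (simp add: F.add)
qed

lemma poly_curve_sum:
  "finite I \<Longrightarrow> (\<And>i. i \<in> I \<Longrightarrow> poly_curve (f i)) \<Longrightarrow> poly_curve (\<lambda>t. \<Sum>i\<in>I. f i t)"
  by (induction I rule: finite_induct) (auto intro: poly_curve_const poly_curve.add)

text \<open>One vector \<open>v m\<close> is eliminated without division: with a functional \<open>\<phi>\<close> that at \<open>t0\<close> is dual to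
  it, the curves \<open>\<phi> (v m t) v i t - \<phi> (v i t) v m t\<close> are again polynomial.\<close>

lemma finite_dependent_parameters:
  assumes "finite I" "\<And>i. i \<in> I \<Longrightarrow> poly_curve (v i)" "independent_family I (\<lambda>i. v i t0)"
  shows "finite {t. \<not> independent_family I (\<lambda>i. v i t)}"
  using assms
proof (induction I arbitrary: v rule: finite_induct)
  case empty
  then show ?case by (simp add: independent_family_def)
next
  case (insert m I)
  let ?S = "(\<lambda>i. v i t0) ` insert m I"
  have ind: "independent ?S" and inj: "inj_on (\<lambda>i. v i t0) (insert m I)"
    using independent_family_image[OF insert.prems(2)] insert.hyps by auto
  define B where "B = extend_basis ?S"
  have B: "independent B" "span B = UNIV" "?S \<subseteq> B"
    unfolding B_def using ind independent_extend_basis extend_basis_superset by auto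
  define \<phi> where "\<phi> = (\<lambda>x. representation B x (v m t0))"
  have lin: "Vector_Spaces.linear scale (*) \<phi>"
    unfolding \<phi>_def by (rule linear_representation[OF B(1,2)])
  interpret \<phi>: Vector_Spaces.linear scale "(*)" \<phi> by (rule lin)
  have \<phi>m: "\<phi> (v m t0) = 1" unfolding \<phi>_def using B by (simp add: representation_basis)
  have \<phi>i: "\<phi> (v i t0) = 0" if "i \<in> I" for i
  proof -
    have "v i t0 \<noteq> v m t0" using inj that insert.hyps by (metis inj_on_def insertI1 insertI2)
    moreover have "v i t0 \<in> B" using B(3) that by blast
    ultimately show ?thesis unfolding \<phi>_def using B(1) by (simp add: representation_basis)
  qed
  define w where "w i t = scale (\<phi> (v m t)) (v i t) - scale (\<phi> (v i t)) (v m t)" for i t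
  obtain q where q: "\<And>t. \<phi> (v m t) = poly q t"
    using poly_curve_functional[OF lin] insert.prems(1) by (metis insertI1)
  have "poly_curve (w i)" if i: "i \<in> I" for i
  proof -
    obtain p where p: "\<And>t. \<phi> (v i t) = poly p t"
      using poly_curve_functional[OF lin] insert.prems(1) i by (metis insertI2)
    have "poly_curve (\<lambda>t. scale (poly q t) (v i t) + scale (poly (- p) t) (v m t))"
      using insert.prems(1) i by (intro poly_curve.add poly_curve_scale) auto
    then show ?thesis by (simp add: w_def[abs_def] p q)
  qed
  moreover have "independent_family I (\<lambda>i. w i t0)"
    unfolding independent_family_def
  proof (intro allI impI ballI)
    fix a j assume a: "(\<Sum>i\<in>I. scale (a i) (w i t0)) = 0" and j: "j \<in> I"
    have "(\<Sum>i\<in>insert m I. scale ((a(m := 0)) i) (v i t0)) = (\<Sum>i\<in>I. scale (a i) (w i t0))"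
      using insert.hyps by (auto simp: w_def \<phi>m \<phi>i intro!: sum.cong)
    then have "(\<Sum>i\<in>insert m I. scale ((a(m := 0)) i) (v i t0)) = 0" using a by (rule trans)
    then have "\<forall>i\<in>insert m I. (a(m := 0)) i = 0"
      using insert.prems(2) unfolding independent_family_def by blast
    then show "a j = 0" using j insert.hyps by (metis fun_upd_other insertI2)
  qed
  ultimately have fin: "finite {t. \<not> independent_family I (\<lambda>i. w i t)}" by (rule insert.IH)
  have "q \<noteq> 0" using q[of t0] \<phi>m by auto
  then have finq: "finite {t. poly q t = 0}" by (rule poly_roots_finite)
  \<comment> \<open>A relation among the \<open>v i t\<close> yields one among the
    \<open>w i t\<close> with the same coefficients on \<open>I\<close>, so these vanish. The
    remaining coefficient is then killed by \<open>poly q t\<close>, whose roots are the additional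
    parameters to exclude.\<close>
  have "independent_family (insert m I) (\<lambda>i. v i t)"
    if t: "independent_family I (\<lambda>i. w i t)" "poly q t \<noteq> 0" for t
    unfolding independent_family_def
  proof (intro allI impI)
    fix a assume a: "(\<Sum>i\<in>insert m I. scale (a i) (v i t)) = 0"
    have "\<phi> (\<Sum>i\<in>insert m I. scale (a i) (v i t)) = 0" unfolding a by (rule \<phi>.zero)
    then have \<phi>s: "a m * \<phi> (v m t) = - (\<Sum>i\<in>I. a i * \<phi> (v i t))"
      using insert.hyps by (simp add: \<phi>.add \<phi>.sum \<phi>.scale eq_neg_iff_add_eq_0)
    have "(\<Sum>i\<in>I. scale (a i) (w i t)) =
        scale (\<phi> (v m t)) (\<Sum>i\<in>I. scale (a i) (v i t)) - scale (\<Sum>i\<in>I. a i * \<phi> (v i t)) (v m t)"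
      by (simp add: w_def scale_right_diff_distrib sum_subtractf scale_sum_right scale_sum_left
          mult.commute)
    also have "\<dots> = scale (\<phi> (v m t)) (\<Sum>i\<in>insert m I. scale (a i) (v i t))"
      using insert.hyps \<phi>s by (simp add: scale_right_distrib mult.commute[of _ "a m"])
    finally have "(\<Sum>i\<in>I. scale (a i) (w i t)) = 0" by (simp only: a) simp
    with t(1) have aI: "\<forall>i\<in>I. a i = 0" by (simp add: independent_family_def)
    then have "a m * \<phi> (v m t) = 0" using \<phi>s by simp
    then show "\<forall>i\<in>insert m I. a i = 0" using aI t(2) q by simp
  qed
  then have "{t. \<not> independent_family (insert m I) (\<lambda>i. v i t)} \<subseteq>
      {t. \<not> independent_family I (\<lambda>i. w i t)} \<union> {t. poly q t = 0}" by blast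
  then show ?case using fin finq by (meson finite_UnI finite_subset)
qed

end

locale char_0_vector_space = finite_dimensional_vector_space scale Basis
  for scale :: "'a::field_char_0 \<Rightarrow> 'b::ab_group_add \<Rightarrow> 'b" and Basis
begin

interpretation endo: vector_space_pair scale scale ..

text \<open>A member with the largest number of eigenvalues has the required property: if another member
  \<open>g\<close> had two eigenvalues on one of its eigenspaces, then \<open>f + n g\<close> would have more eigenvalues
  for almost all \<open>n\<close>.\<close>

lemma exists_separating_operator:
  fixes \<F> :: "('b \<Rightarrow> 'b) set"
  assumes "\<F> \<noteq> {}" and lin: "\<And>f. f \<in> \<F> \<Longrightarrow> Vector_Spaces.linear scale scale f"
    and diag: "\<And>f. f \<in> \<F> \<Longrightarrow> diagonalizable f"
    and comm: "\<And>f g v. f \<in> \<F> \<Longrightarrow> g \<in> \<F> \<Longrightarrow> f (g v) = g (f v)"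
    and closed: "\<And>f g n. f \<in> \<F> \<Longrightarrow> g \<in> \<F> \<Longrightarrow> (\<lambda>v. f v + scale (of_nat n) (g v)) \<in> \<F>"
  obtains f where "f \<in> \<F>" "\<And>g c. g \<in> \<F> \<Longrightarrow> \<exists>d. \<forall>v\<in>eigenspace f c. g v = scale d v"
proof -
  obtain f0 where "f0 \<in> \<F>" using assms(1) by blast
  then obtain f where f: "f \<in> \<F>" and max: "\<And>g. g \<in> \<F> \<Longrightarrow> card (spectrum g) \<le> card (spectrum f)"
    using ex_has_greatest_nat[of "\<lambda>f. f \<in> \<F>" f0 "\<lambda>f. card (spectrum f)" "dim UNIV + 1"]
      card_spectrum_le[OF lin] by (metis add.commute le_imp_less_Suc plus_1_eq_Suc)
  have decomp: "\<exists>\<Lambda> u. finite \<Lambda> \<and> (\<forall>d\<in>\<Lambda>. u d \<in> eigenspace g d \<inter> eigenspace f c) \<and> v = (\<Sum>d\<in>\<Lambda>. u d)"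
    if g: "g \<in> \<F>" and v: "v \<in> eigenspace f c" for g c v
  proof -
    have "g w \<in> eigenspace f c" if "w \<in> eigenspace f c" for w
      using that comm[OF f g, of w] endo.linear_scale[OF lin[OF g]] by (simp add: eigenspace_def)
    from diagonalizable_decompose[OF lin[OF g] subspace_eigenspace[OF lin[OF f]] this diag[OF g] v]
    show ?thesis by (metis IntI)
  qed
  have "\<exists>d. \<forall>v\<in>eigenspace f c. g v = scale d v" if g: "g \<in> \<F>" for g c
  proof (rule ccontr)
    assume neg: "\<not> ?thesis"
    \<comment> \<open>The joint spectrum of \<open>f\<close> and \<open>g\<close>. It projects onto
      the spectrum of \<open>f\<close>, not injectively if \<open>g\<close> has two eigenvalues over
      \<open>c\<close>, whereas a suitable \<open>n\<close> embeds it into the spectrum of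
      \<open>f + n g\<close>.\<close>
    define P where "P = {(c, d). \<exists>v\<in>eigenspace f c \<inter> eigenspace g d. v \<noteq> 0}"
    have "P \<subseteq> spectrum f \<times> spectrum g" by (auto simp: P_def spectrum_def)
    then have finP: "finite P"
      using finite_spectrum[OF lin[OF f]] finite_spectrum[OF lin[OF g]]
      by (meson finite_SigmaI finite_subset)
    have nz: "\<exists>d. (c', d) \<in> P" if "c' \<in> spectrum f" for c'
    proof -
      from that obtain v where v: "v \<in> eigenspace f c'" "v \<noteq> 0" by (auto simp: spectrum_def)
      from decomp[OF g v(1)] obtain \<Lambda> u where
        u: "\<forall>d\<in>\<Lambda>. u d \<in> eigenspace g d \<inter> eigenspace f c'" "v = (\<Sum>d\<in>\<Lambda>. u d)" by blast
      from u(2) v(2) obtain d where "d \<in> \<Lambda>" "u d \<noteq> 0" by (metis sum.neutral)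
      then show ?thesis using u(1) by (auto simp: P_def)
    qed
    then have "spectrum f \<subseteq> fst ` P" by force
    have "\<exists>d1 d2. d1 \<noteq> d2 \<and> (c, d1) \<in> P \<and> (c, d2) \<in> P"
    proof (rule ccontr)
      assume "\<not> ?thesis"
      then obtain d where d: "\<And>d'. (c, d') \<in> P \<Longrightarrow> d' = d" by blast
      have "g v = scale d v" if v: "v \<in> eigenspace f c" for v
      proof -
        from decomp[OF g v(1)] obtain \<Lambda> u where
          u: "\<forall>d\<in>\<Lambda>. u d \<in> eigenspace g d \<inter> eigenspace f c" "v = (\<Sum>d\<in>\<Lambda>. u d)" by blast
        have "g (u d') = scale d (u d')" if "d' \<in> \<Lambda>" for d'
        proof (cases "u d' = 0")
          case True
          then show ?thesis using endo.linear_0[OF lin[OF g]] by simp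
        next
          case False
          then have "(c, d') \<in> P" using u(1) that by (auto simp: P_def)
          then have "d' = d" by (rule d)
          then show ?thesis using u(1) that by (auto simp: eigenspace_def)
        qed
        then show ?thesis unfolding u(2) endo.linear_sum[OF lin[OF g]] scale_sum_right
          by (intro sum.cong) auto
      qed
      then show False using neg by blast
    qed
    then have "\<not> inj_on fst P" unfolding inj_on_def by force
    then have "card (fst ` P) < card P"
      using finP card_image_le eq_card_imp_inj_on by (metis le_neq_implies_less)
    moreover have "card (spectrum f) \<le> card (fst ` P)"
      using \<open>spectrum f \<subseteq> fst ` P\<close> finP by (intro card_mono) auto
    moreover have "\<exists>n. inj_on (\<lambda>(c, d). c + of_nat n * d) P"
      using finite_collisions[OF finP] ex_new_if_finite[OF infinite_UNIV_nat] by blast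
    then obtain n :: nat where n: "inj_on (\<lambda>(c, d). c + of_nat n * d) P" by blast
    let ?k = "\<lambda>v. f v + scale (of_nat n) (g v)"
    have k: "?k \<in> \<F>" using closed f g by blast
    have "(\<lambda>(c, d). c + of_nat n * d) ` P \<subseteq> spectrum ?k"
      by (force simp: P_def spectrum_def eigenspace_def scale_left_distrib)
    then have "card P \<le> card (spectrum ?k)"
      using card_mono[OF finite_spectrum[OF lin[OF k]]] card_image[OF n] by metis
    moreover have "card (spectrum ?k) \<le> card (spectrum f)" by (rule max[OF k])
    ultimately show False by linarith
  qed
  with f show ?thesis using that by blast
qed

end

section \<open>Invariance of the rank\<close>

lemma poly_interpolate:
  fixes S :: "'f::field set"
  assumes "finite S"
  obtains p where "\<And>c. c \<in> S \<Longrightarrow> poly p c = f c"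
proof -
  have "\<exists>p. \<forall>c\<in>S. poly p c = f c"
    using assms
  proof (induction S rule: finite_induct)
    case (insert a S)
    then obtain p where p: "\<forall>c\<in>S. poly p c = f c" by blast
    let ?q = "\<Prod>c\<in>S. [:- c, 1:]"
    have "poly ?q a \<noteq> 0" using insert.hyps by (auto simp: poly_prod)
    moreover have "poly ?q c = 0" if "c \<in> S" for c
      using that insert.hyps by (auto simp: poly_prod)
    ultimately show ?case
      using p by (intro exI[of _ "p + smult ((f a - poly p a) / poly ?q a) ?q"]) auto
  qed simp
  then show ?thesis using that by blast
qed

context finite_dimensional_vector_space
begin

interpretation endo: vector_space_pair scale scale ..

lemma operator_trace_comp_swap:
  assumes F: "Vector_Spaces.linear scale scale F" and G: "Vector_Spaces.linear scale scale G"
  shows "operator_trace (\<lambda>v. F (G v)) = operator_trace (\<lambda>v. G (F v))"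
  unfolding operator_trace_def Let_def
  by (rule trace_comp_swap[OF F G]) (simp_all add: independent_extend_basis independent_empty)

lemma operator_trace_add:
  "operator_trace (\<lambda>v. F v + G v) = operator_trace F + operator_trace G"
  unfolding operator_trace_def Let_def
  by (simp add: independent_extend_basis independent_empty representation_add sum.distrib)

lemma operator_trace_diff:
  "operator_trace (\<lambda>v. F v - G v) = operator_trace F - operator_trace G"
  unfolding operator_trace_def Let_def
  by (simp add: independent_extend_basis independent_empty representation_diff sum_subtractf)

lemma operator_trace_scale:
  "operator_trace (\<lambda>v. scale c (F v)) = c * operator_trace F"
  unfolding operator_trace_def Let_def
  by (simp add: independent_extend_basis independent_empty representation_scale sum_distrib_left)

lemma operator_trace_sum:
  "finite I \<Longrightarrow> operator_trace (\<lambda>v. \<Sum>i\<in>I. F i v) = (\<Sum>i\<in>I. operator_trace (F i))"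
proof (induction I rule: finite_induct)
  case empty
  show ?case using operator_trace_scale[of 0 "\<lambda>_. 0"] by simp
next
  case (insert i I)
  then show ?case by (simp add: operator_trace_add)
qed

end

context lie_algebra
begin

interpretation endo: vector_space_pair scale scale ..

lemma linear_bracket: "Vector_Spaces.linear scale scale (bracket x)"
  unfolding Vector_Spaces.linear_iff
  using bracket_add_right bracket_scale_right vector_space_axioms by blast

lemmas bracket_zero_right [simp] = endo.linear_0[OF linear_bracket]
lemmas bracket_minus_right = endo.linear_neg[OF linear_bracket]
lemmas bracket_diff_right = endo.linear_diff[OF linear_bracket]
lemmas bracket_sum_right = endo.linear_sum[OF linear_bracket]

lemma bracket_swap: "bracket x y = - bracket y x"
proof -
  have "bracket (x + y) (x + y) = bracket x y + bracket y x"
    by (simp only: bracket_add_left, simp add: bracket_add_right bracket_self)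
  then show ?thesis by (simp add: bracket_self eq_neg_iff_add_eq_0)
qed

lemma bracket_zero_left [simp]: "bracket 0 x = 0"
  by (subst bracket_swap) simp

lemma bracket_minus_left: "bracket (- x) y = - bracket x y"
  by (subst bracket_swap) (simp add: bracket_minus_right bracket_swap[of y x])

lemma bracket_diff_left: "bracket (x - y) z = bracket x z - bracket y z"
  by (simp add: bracket_swap[of _ z] bracket_diff_right)

lemma bracket_sum_left: "bracket (\<Sum>i\<in>I. f i) y = (\<Sum>i\<in>I. bracket (f i) y)"
  by (subst bracket_swap) (simp add: bracket_sum_right bracket_swap[of y] sum_negf)

lemma bracket_bracket_left: "bracket (bracket x y) z = bracket x (bracket y z) - bracket y (bracket x z)"
  using jacobi[of x y z] bracket_swap[of "bracket x y" z] bracket_swap[of x z]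
  by (simp add: bracket_minus_right neg_eq_iff_add_eq_0 ac_simps)

end

locale fd_lie_algebra = lie_algebra scale bracket + char_0_vector_space scale Basis
  for scale :: "'f::field_char_0 \<Rightarrow> 'a::ab_group_add \<Rightarrow> 'a" and bracket and Basis
begin

interpretation endo: vector_space_pair scale scale ..

lemma linear_bracket_power: "Vector_Spaces.linear scale scale (bracket x ^^ k)"
proof (induction k)
  case 0
  show ?case using linear_id by (simp add: id_def)
next
  case (Suc k)
  show ?case unfolding funpow.simps by (rule Vector_Spaces.linear_compose[OF Suc linear_bracket])
qed

section \<open>Bilinearity and invariance of the Killing form\<close>

lemma killing_form_sym: "killing_form x y = killing_form y x"
  unfolding killing_form_def by (rule operator_trace_comp_swap) (rule linear_bracket)+

lemma killing_form_add_right: "killing_form x (y + z) = killing_form x y + killing_form x z"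
  by (simp add: killing_form_def bracket_add_left bracket_add_right operator_trace_add)

lemma killing_form_scale_right: "killing_form x (scale c y) = c * killing_form x y"
  by (simp add: killing_form_def bracket_scale_left bracket_scale_right operator_trace_scale)

lemma killing_form_add_left: "killing_form (x + y) z = killing_form x z + killing_form y z"
  by (simp add: killing_form_sym[of _ z] killing_form_add_right)

lemma killing_form_scale_left: "killing_form (scale c x) y = c * killing_form x y"
  by (simp add: killing_form_sym[of _ y] killing_form_scale_right)

text \<open>Cyclicity of the trace, since a power of \<open>bracket x\<close> commutes with
  \<open>bracket x\<close>. It is the reason why the gradients of the trace polynomials at
  \<open>x\<close> commute with \<open>x\<close>.\<close>

lemma trace_power_bracket_invariant:
  "operator_trace (\<lambda>v. (bracket x ^^ k) (bracket (bracket x y) v)) = 0"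
proof -
  let ?X = "bracket x ^^ k" and ?Y = "bracket y"
  have lin: "Vector_Spaces.linear scale scale (\<lambda>v. ?X (?Y v))"
    using Vector_Spaces.linear_compose[OF linear_bracket linear_bracket_power] by (simp add: o_def)
  have "operator_trace (\<lambda>v. ?X (?Y (bracket x v))) = operator_trace (\<lambda>v. bracket x (?X (?Y v)))"
    by (rule operator_trace_comp_swap[OF lin linear_bracket])
  also have "\<dots> = operator_trace (\<lambda>v. ?X (bracket x (?Y v)))"
    by (simp add: funpow_swap1)
  finally show ?thesis
    by (simp add: bracket_bracket_left endo.linear_diff[OF linear_bracket_power] operator_trace_diff)
qed

lemma killing_form_invariant: "killing_form (bracket x y) z = killing_form x (bracket y z)"
proof -
  have lin: "Vector_Spaces.linear scale scale (\<lambda>v. bracket a (bracket b v))" for a b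
    using Vector_Spaces.linear_compose[OF linear_bracket[of b] linear_bracket[of a]] by (simp add: o_def)
  have "operator_trace (\<lambda>v. bracket y (bracket x (bracket z v))) =
      operator_trace (\<lambda>v. bracket x (bracket z (bracket y v)))"
    using operator_trace_comp_swap[OF linear_bracket lin] .
  then show ?thesis
    by (simp add: killing_form_def bracket_bracket_left bracket_diff_right operator_trace_diff)
qed

lemma killing_form_sum_right: "killing_form x (\<Sum>i\<in>I. f i) = (\<Sum>i\<in>I. killing_form x (f i))"
  by (induction I rule: infinite_finite_induct)
    (use killing_form_scale_right[of x 0 0] in \<open>auto simp: killing_form_add_right\<close>)

lemma killing_form_sum_left: "killing_form (\<Sum>i\<in>I. f i) x = (\<Sum>i\<in>I. killing_form (f i) x)"
  by (simp only: killing_form_sym[of _ x] killing_form_sum_right)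

section \<open>Cartan subalgebras as centralizers of regular elements\<close>

lemma subspace_centralizer: "subspace (centralizer x)"
  unfolding centralizer_def subspace_def
  by (auto simp: bracket_add_left bracket_scale_left)

text \<open>By Jacobi the adjoint operators of the abelian \<open>H\<close> commute, so a separating
  one exists among them. On each of its eigenspaces all of \<open>H\<close> acts by scalars.\<close>

lemma cartan_separating_element:
  assumes H: "cartan_subalgebra H"
  obtains h where "h \<in> H" "\<And>z c. z \<in> H \<Longrightarrow> \<exists>d. \<forall>v\<in>eigenspace (bracket h) c. bracket z v = scale d v"
proof -
  have sub: "subspace H" and ab: "\<And>x y. x \<in> H \<Longrightarrow> y \<in> H \<Longrightarrow> bracket x y = 0"
    and diag: "\<And>x. x \<in> H \<Longrightarrow> diagonalizable (bracket x)"
    using H unfolding cartan_subalgebra_def by auto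
  obtain f where f: "f \<in> bracket ` H"
    "\<And>g c. g \<in> bracket ` H \<Longrightarrow> \<exists>d. \<forall>v\<in>eigenspace f c. g v = scale d v"
  proof (rule exists_separating_operator[of "bracket ` H"])
    show "bracket ` H \<noteq> {}" using subspace_0[OF sub] by blast
    show "f (g v) = g (f v)" if "f \<in> bracket ` H" "g \<in> bracket ` H" for f g v
    proof -
      from that obtain x y where xy: "x \<in> H" "y \<in> H" "f = bracket x" "g = bracket y" by blast
      then show ?thesis using bracket_bracket_left[of x y v] ab by simp
    qed
    show "(\<lambda>v. f v + scale (of_nat n) (g v)) \<in> bracket ` H"
      if fg: "f \<in> bracket ` H" "g \<in> bracket ` H" for f g n
    proof -
      from fg obtain x y where xy: "x \<in> H" "y \<in> H" "f = bracket x" "g = bracket y" by blast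
      then have "(\<lambda>v. f v + scale (of_nat n) (g v)) = bracket (x + scale (of_nat n) y)"
        by (simp add: bracket_add_left bracket_scale_left fun_eq_iff)
      then show ?thesis using xy sub by (auto intro!: imageI subspace_add subspace_scale)
    qed
  qed (use linear_bracket diag in auto)
  then show ?thesis using that by blast
qed

text \<open>For a separating \<open>h\<close>, each \<open>y\<close> in \<open>H\<close> acts on the
  zero eigenspace of \<open>bracket h\<close> by one scalar. This eigenspace contains
  \<open>y\<close>, and \<open>bracket y y = 0\<close>, so the scalar vanishes unless
  \<open>y = 0\<close>. Hence everything commuting with \<open>h\<close> commutes with
  \<open>H\<close>, and maximality applies.\<close>

lemma cartan_regular_element:
  assumes H: "cartan_subalgebra H"
  obtains h where "h \<in> H" "centralizer h = H"
proof -
  have ab: "\<And>x y. x \<in> H \<Longrightarrow> y \<in> H \<Longrightarrow> bracket x y = 0"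
    and max: "\<And>x. (\<And>y. y \<in> H \<Longrightarrow> bracket x y = 0) \<Longrightarrow> x \<in> H"
    using H unfolding cartan_subalgebra_def by auto
  obtain h where h: "h \<in> H"
    "\<And>z c. z \<in> H \<Longrightarrow> \<exists>d. \<forall>v\<in>eigenspace (bracket h) c. bracket z v = scale d v"
    using cartan_separating_element[OF H] by blast
  have "centralizer h \<subseteq> H"
  proof
    fix x assume "x \<in> centralizer h"
    then have x: "x \<in> eigenspace (bracket h) 0"
      using bracket_swap[of h x] by (simp add: centralizer_def eigenspace_def)
    show "x \<in> H"
    proof (rule max)
      fix y assume y: "y \<in> H"
      obtain d where d: "\<forall>v\<in>eigenspace (bracket h) 0. bracket y v = scale d v" using h(2)[OF y] by blast
      have "y \<in> eigenspace (bracket h) 0" using ab[OF h(1) y] by (simp add: eigenspace_def)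
      then have "d = 0 \<or> y = 0" using d bracket_self[of y] by auto
      then have "bracket y x = 0" using d x by auto
      then show "bracket x y = 0" using bracket_swap[of x y] by simp
    qed
  qed
  moreover have "H \<subseteq> centralizer h" using ab h(1) by (auto simp: centralizer_def)
  ultimately show ?thesis using h(1) that by blast
qed

text \<open>Nondegeneracy makes the matrix \<open>J\<close> of the Killing form invertible, and
  \<open>R\<close> is its inverse. A linear \<open>R\<close> is wanted, since vectors obtained from
  it inherit polynomial dependence on a parameter.\<close>

lemma killing_form_representation:
  assumes nondeg: "\<And>z. (\<And>w. killing_form z w = 0) \<Longrightarrow> z = 0"
  obtains R where "Vector_Spaces.linear scale scale R"
    "\<And>w y. killing_form (R w) y = (\<Sum>b\<in>Basis. representation Basis w b * representation Basis y b)"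
proof -
  interpret fe: finite_dimensional_vector_space_pair scale Basis scale Basis ..
  define J where "J z = (\<Sum>b\<in>Basis. scale (killing_form z b) b)" for z
  have J: "Vector_Spaces.linear scale scale J"
    unfolding Vector_Spaces.linear_iff J_def
    by (auto simp: vector_space_axioms killing_form_add_left killing_form_scale_left
        scale_left_distrib sum.distrib scale_sum_right)
  have Jrep: "representation Basis (J z) b = killing_form z b" if "b \<in> Basis" for z b
    unfolding J_def using that independent_Basis span_Basis
    by (simp add: representation_sum representation_scale representation_basis if_distrib
        sum.delta finite_Basis cong: if_cong)
  have expand: "killing_form z y = (\<Sum>b\<in>Basis. killing_form z b * representation Basis y b)" for z y
  proof -
    have "y = (\<Sum>b\<in>Basis. scale (representation Basis y b) b)"
      using independent_Basis span_Basis finite_Basis by (simp add: sum_representation_eq)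
    then have "killing_form z y = killing_form z (\<Sum>b\<in>Basis. scale (representation Basis y b) b)"
      by simp
    then show ?thesis by (simp add: killing_form_sum_right killing_form_scale_right mult.commute)
  qed
  have "inj J"
  proof (subst endo.linear_inj_iff_eq_0[OF J], intro allI impI)
    fix z assume "J z = 0"
    then have "killing_form z b = 0" if "b \<in> Basis" for b
      using Jrep[OF that, of z] by (simp add: representation_zero)
    then have "killing_form z y = 0" for y by (subst expand) simp
    then show "z = 0" by (rule nondeg)
  qed
  then obtain R where R: "Vector_Spaces.linear scale scale R" "\<And>w. J (R w) = w"
    using fe.linear_injective_isomorphism[OF J] by auto
  show ?thesis
    by (rule that[OF R(1)], subst expand) (simp add: Jrep[symmetric] R(2))
qed

text \<open>The vectors \<open>z k x\<close> with \<open>killing_form (z k x) y = tr ((ad x)^k ad y)\<close> are the gradients of the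
  invariant polynomials \<open>tr (ad x)^(k+1)\<close>; they commute with \<open>x\<close> and depend polynomially on it.
  At a separating element of \<open>H\<close> they span \<open>H\<close>, hence along the line through \<open>x\<close> almost all
  centralizers have dimension at least \<open>dim H\<close>, and the dimension can only jump up at \<open>x\<close>.\<close>

theorem dim_cartan_le_dim_centralizer:
  assumes nondeg: "\<And>z. (\<And>w. killing_form z w = 0) \<Longrightarrow> z = 0"
    and H: "cartan_subalgebra H"
  shows "dim H \<le> dim (centralizer x)"
proof -
  obtain R where R: "Vector_Spaces.linear scale scale R"
    "\<And>w y. killing_form (R w) y = (\<Sum>b\<in>Basis. representation Basis w b * representation Basis y b)"
    using killing_form_representation[OF nondeg] by blast
  define tr where "tr k x y = operator_trace (\<lambda>v. (bracket x ^^ k) (bracket y v))" for k x y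
  define z where "z k x = R (\<Sum>b\<in>Basis. scale (tr k x b) b)" for k x
  have tr_expand: "tr k x y = (\<Sum>b\<in>Basis. representation Basis y b * tr k x b)" for k x y
  proof -
    have "y = (\<Sum>b\<in>Basis. scale (representation Basis y b) b)"
      using independent_Basis span_Basis finite_Basis by (simp add: sum_representation_eq)
    then have "bracket y = bracket (\<Sum>b\<in>Basis. scale (representation Basis y b) b)"
      by simp
    then show ?thesis
      by (simp add: tr_def bracket_sum_left bracket_scale_left finite_Basis operator_trace_scale
          endo.linear_sum[OF linear_bracket_power] endo.linear_scale[OF linear_bracket_power]
          operator_trace_sum)
  qed
  have kz: "killing_form (z k x) y = tr k x y" for k x y
  proof -
    have "representation Basis (\<Sum>b\<in>Basis. scale (tr k x b) b) b = tr k x b" if "b \<in> Basis" for b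
      using that independent_Basis span_Basis
      by (simp add: representation_sum representation_scale representation_basis if_distrib
          sum.delta finite_Basis cong: if_cong)
    then show ?thesis by (subst tr_expand) (simp add: z_def R(2) mult.commute)
  qed
  have z_central: "bracket (z k x) x = 0" for k x
  proof (rule nondeg)
    fix y show "killing_form (bracket (z k x) x) y = 0"
      by (simp add: killing_form_invariant kz tr_def trace_power_bracket_invariant)
  qed
  have eqI: "a = b" if "\<And>y. killing_form a y = killing_form b y" for a b
  proof -
    have "a - b = 0"
    proof (rule nondeg)
      fix w show "killing_form (a - b) w = 0"
        using that[of w] killing_form_add_left[of "a - b" b w] by simp
    qed
    then show ?thesis by simp
  qed
  obtain h where h: "h \<in> H"
    "\<And>z c. z \<in> H \<Longrightarrow> \<exists>d. \<forall>v\<in>eigenspace (bracket h) c. bracket z v = scale d v"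
    using cartan_separating_element[OF H] by blast
  have diag: "diagonalizable (bracket h)" using H h(1) by (auto simp: cartan_subalgebra_def)
  \<comment> \<open>For \<open>w\<close> in \<open>H\<close> the operator \<open>bracket w\<close>
    is scalar on each eigenspace of \<open>bracket h\<close>, so interpolation at the eigenvalues
    writes it as a polynomial in \<open>bracket h\<close>. Pairing with the Killing form turns its
    coefficients into coefficients of \<open>w\<close> in terms of the \<open>z i h\<close>.\<close>
  have H_span: "H \<subseteq> span (range (\<lambda>k. z k h))"
  proof
    fix w assume w: "w \<in> H"
    obtain d where d: "\<And>c v. v \<in> eigenspace (bracket h) c \<Longrightarrow> bracket w v = scale (d c) v"
      using h(2)[OF w] by metis
    obtain p where p: "\<And>c. c \<in> spectrum (bracket h) \<Longrightarrow> poly p c = d c"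
      using poly_interpolate[OF finite_spectrum[OF linear_bracket]] by blast
    let ?P = "\<lambda>v. \<Sum>i\<le>degree p. scale (coeff p i) ((bracket h ^^ i) v)"
    have P: "Vector_Spaces.linear scale scale ?P"
      by (intro endo.linear_compose_sum ballI endo.linear_compose_scale_right linear_bracket_power)
    have eig: "bracket w v = ?P v" if v: "v \<in> eigenspace (bracket h) c" for v c
    proof (cases "v = 0")
      case True
      then show ?thesis by (simp add: endo.linear_0[OF linear_bracket_power])
    next
      case False
      then have c: "c \<in> spectrum (bracket h)" using v by (auto simp: spectrum_def)
      have "(bracket h ^^ i) v = scale (c ^ i) v" for i
        using v by (induction i) (auto simp: eigenspace_def bracket_scale_right mult.commute)
      then have "?P v = scale (poly p c) v" by (simp add: poly_altdef scale_sum_left)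
      then show ?thesis using d[OF v] p[OF c] by simp
    qed
    have wP: "bracket w v = ?P v" for v
    proof -
      obtain \<Lambda> u where u: "finite \<Lambda>" "\<And>c. c \<in> \<Lambda> \<Longrightarrow> u c \<in> eigenspace (bracket h) c" "v = (\<Sum>c\<in>\<Lambda>. u c)"
        using diagonalizable_decompose[OF linear_bracket subspace_UNIV _ diag, of v] by blast
      then have "bracket w v = (\<Sum>c\<in>\<Lambda>. ?P (u c))"
        unfolding u(3) bracket_sum_right using eig u(2) by (intro sum.cong) auto
      also have "\<dots> = ?P v" unfolding u(3) by (rule endo.linear_sum[OF P, symmetric])
      finally show ?thesis .
    qed
    have "w = (\<Sum>i\<le>degree p. scale (coeff p i) (z i h))"
    proof (rule eqI)
      fix y
      have "killing_form w y = operator_trace (\<lambda>v. ?P (bracket y v))"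
        unfolding killing_form_def wP ..
      also have "\<dots> = (\<Sum>i\<le>degree p. coeff p i * tr i h y)"
        by (simp add: tr_def operator_trace_sum operator_trace_scale)
      also have "\<dots> = killing_form (\<Sum>i\<le>degree p. scale (coeff p i) (z i h)) y"
        by (simp add: killing_form_sum_left killing_form_scale_left kz)
      finally show "killing_form w y = killing_form (\<Sum>i\<le>degree p. scale (coeff p i) (z i h)) y" .
    qed
    then show "w \<in> span (range (\<lambda>k. z k h))"
      by (auto intro!: span_sum span_scale intro: span_base)
  qed
  obtain B where B: "B \<subseteq> range (\<lambda>k. z k h)" "independent B" "range (\<lambda>k. z k h) \<subseteq> span B"
    using maximal_independent_subset by blast
  have finB: "finite B" by (rule finiteI_independent[OF B(2)])
  have "H \<subseteq> span B" using H_span span_minimal[OF B(3) subspace_span] by blast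
  then have dimH: "dim H \<le> card B" by (rule dim_le_card[OF _ finB])
  obtain k where k: "\<And>b. b \<in> B \<Longrightarrow> z (k b) h = b" using B(1) by (metis imageE subsetD)
  \<comment> \<open>The line with \<open>y 0 = h\<close> and \<open>y 1 = x\<close>. One
    independence statement is known at 0, another at 1; each fails for finitely many parameters
    only, so some \<open>t\<close> satisfies both.\<close>
  define y where "y t = h + scale t (x - h)" for t
  have curve_bracket: "poly_curve (\<lambda>t. bracket (y t) (f t))" if "poly_curve f" for f
  proof -
    have "poly_curve (\<lambda>t. bracket h (f t) + scale (poly [:0, 1:] t) (bracket (x - h) (f t)))"
      using that by (intro poly_curve.add poly_curve_scale poly_curve_linear[OF linear_bracket])
    then show ?thesis by (simp add: y_def bracket_add_left bracket_scale_left)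
  qed
  have curve_power: "poly_curve (\<lambda>t. (bracket (y t) ^^ i) w)" for i w
    by (induction i) (auto intro: poly_curve_const curve_bracket)
  have tr_poly: "\<exists>p. \<forall>t. tr i (y t) w = poly p t" for i w
  proof -
    have "\<exists>p. \<forall>t. representation Basis ((bracket (y t) ^^ i) (bracket w b)) b = poly p t" for b
      by (rule poly_curve_functional[OF linear_representation[OF independent_Basis span_Basis] curve_power])
    then obtain P where P: "\<And>b t. representation Basis ((bracket (y t) ^^ i) (bracket w b)) b = poly (P b) t"
      by metis
    have "tr i (y t) w = (\<Sum>b\<in>Basis. representation Basis ((bracket (y t) ^^ i) (bracket w b)) b)" for t
      unfolding tr_def
      using Vector_Spaces.linear_compose[OF linear_bracket linear_bracket_power]
      by (intro operator_trace_basis independent_Basis span_Basis) (simp add: o_def)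
    then have "tr i (y t) w = poly (\<Sum>b\<in>Basis. P b) t" for t
      by (simp add: P poly_sum)
    then show ?thesis by blast
  qed
  have curve_z: "poly_curve (\<lambda>t. z i (y t))" for i
    unfolding z_def
  proof (intro poly_curve_linear[OF R(1)] poly_curve_sum finite_Basis)
    fix b
    obtain p where "\<And>t. tr i (y t) b = poly p t" using tr_poly[of i b] by blast
    then show "poly_curve (\<lambda>t. scale (tr i (y t) b) b)" by (simp add: poly_curve.monom)
  qed
  have "independent_family B (\<lambda>b. z (k b) (y 0))"
    unfolding independent_family_def
  proof (intro allI impI)
    fix a assume "(\<Sum>b\<in>B. scale (a b) (z (k b) (y 0))) = 0"
    moreover have "(\<Sum>b\<in>B. scale (a b) (z (k b) (y 0))) = (\<Sum>b\<in>B. scale (a b) b)"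
      by (rule sum.cong) (auto simp: k y_def)
    ultimately have "(\<Sum>b\<in>B. scale (a b) b) = 0" by simp
    with independent_family_id[OF B(2) finB] show "\<forall>b\<in>B. a b = 0"
      unfolding independent_family_def by blast
  qed
  then have fin1: "finite {t. \<not> independent_family B (\<lambda>b. z (k b) (y t))}"
    using curve_z finB by (intro finite_dependent_parameters[of _ _ 0]) auto
  obtain C where C: "C \<subseteq> centralizer x" "independent C" "centralizer x \<subseteq> span C" "card C = dim (centralizer x)"
    using basis_exists[of "centralizer x"] by metis
  \<comment> \<open>A basis of a complement of the kernel of \<open>bracket x\<close>. Injectivity
    on its span persists along the line for almost all \<open>t\<close>, which bounds the
    centralizer of \<open>y t\<close> by the dimension of that of \<open>x\<close>.\<close>
  define W where "W = extend_basis C - C"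
  have E: "independent (extend_basis C)" "C \<subseteq> extend_basis C" "span (extend_basis C) = UNIV"
    using independent_extend_basis[OF C(2)] extend_basis_superset[OF C(2)] C(2) by auto
  have finE: "finite (extend_basis C)" by (rule finiteI_independent[OF E(1)])
  have cardE: "card (extend_basis C) = dim UNIV"
    using E by (metis dim_eq_card_independent dim_span)
  have finW: "finite W" using finE by (simp add: W_def)
  have cardW: "card W + dim (centralizer x) = dim UNIV"
    using cardE C(4) card_Diff_subset[OF finite_subset[OF E(2) finE] E(2)] card_mono[OF finE E(2)]
    unfolding W_def by linarith
  have indW: "independent W" using E(1) independent_mono unfolding W_def by blast
  have "independent_family W (\<lambda>w. bracket (y 1) w)"
    unfolding independent_family_def
  proof (intro allI impI)
    fix a assume "(\<Sum>w\<in>W. scale (a w) (bracket (y 1) w)) = 0"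
    then have "bracket x (\<Sum>w\<in>W. scale (a w) w) = 0"
      by (simp add: y_def bracket_sum_right bracket_scale_right)
    then have "(\<Sum>w\<in>W. scale (a w) w) \<in> span C"
      using bracket_swap[of _ x] C(3) by (auto simp: centralizer_def)
    then obtain c where c: "(\<Sum>w\<in>W. scale (a w) w) = (\<Sum>w\<in>C. scale (c w) w)"
      using span_finite[OF finite_subset[OF E(2) finE]] by auto
    define g where "g w = (if w \<in> C then - c w else a w)" for w
    have "(\<Sum>w\<in>extend_basis C. scale (g w) w) = (\<Sum>w\<in>W. scale (g w) w) + (\<Sum>w\<in>C. scale (g w) w)"
      unfolding W_def by (rule sum.subset_diff[OF E(2) finE])
    also have "(\<Sum>w\<in>W. scale (g w) w) = (\<Sum>w\<in>W. scale (a w) w)"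
      by (intro sum.cong) (auto simp: g_def W_def)
    also have "(\<Sum>w\<in>C. scale (g w) w) = - (\<Sum>w\<in>C. scale (c w) w)"
      by (simp add: g_def sum_negf)
    finally have "(\<Sum>w\<in>extend_basis C. scale (g w) w) = 0" using c by simp
    then have g0: "g w = 0" if "w \<in> extend_basis C" for w
      using independentD[OF E(1) finE order.refl] that by blast
    show "\<forall>w\<in>W. a w = 0"
    proof
      fix w assume "w \<in> W"
      then show "a w = 0" using g0[of w] by (simp add: g_def W_def)
    qed
  qed
  then have fin2: "finite {t. \<not> independent_family W (\<lambda>w. bracket (y t) w)}"
    using finW by (intro finite_dependent_parameters[of _ _ 1] curve_bracket poly_curve_const) auto
  obtain t where t1: "independent_family B (\<lambda>b. z (k b) (y t))"
    and t2: "independent_family W (\<lambda>w. bracket (y t) w)"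
    using ex_new_if_finite[OF infinite_UNIV_char_0, of "{t. \<not> independent_family B (\<lambda>b. z (k b) (y t))} \<union>
        {t. \<not> independent_family W (\<lambda>w. bracket (y t) w)}"] fin1 fin2 by auto
  have "card B \<le> dim (centralizer (y t))"
    using z_central by (intro independent_family_card_le_dim[OF t1 finB]) (auto simp: centralizer_def)
  moreover have "dim (centralizer (y t)) + dim (span W) \<le> dim UNIV"
  proof (rule dim_add_le)
    show "centralizer (y t) \<inter> span W \<subseteq> {0}"
    proof
      fix v assume v: "v \<in> centralizer (y t) \<inter> span W"
      then obtain a where a: "v = (\<Sum>w\<in>W. scale (a w) w)" using finW by (auto simp: span_finite)
      have "bracket (y t) v = 0" using v bracket_swap[of _ v] by (simp add: centralizer_def)
      then have "(\<Sum>w\<in>W. scale (a w) (bracket (y t) w)) = 0"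
        by (simp add: a bracket_sum_right bracket_scale_right)
      then have "\<forall>w\<in>W. a w = 0" using t2 by (simp add: independent_family_def)
      then show "v \<in> {0}" by (simp add: a)
    qed
  qed (auto simp: subspace_centralizer)
  moreover have "dim (span W) = card W" using indW by (simp add: dim_eq_card_independent)
  ultimately show ?thesis using dimH cardW by linarith
qed

text \<open>Each of the two is the centralizer of one of its elements, so the lower bound on
  centralizers applies in both directions.\<close>

lemma dim_cartan_unique:
  assumes nondeg: "\<And>z. (\<And>w. killing_form z w = 0) \<Longrightarrow> z = 0"
    and "cartan_subalgebra H" "cartan_subalgebra H'"
  shows "dim H = dim H'"
  using dim_cartan_le_dim_centralizer[OF nondeg] cartan_regular_element assms(2,3)
  by (metis order.antisym)

end

section \<open>Compact conjugations and even weights\<close>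

text \<open>The complexification of a real Lie algebra of compact type, with its conjugation \<open>conj\<close>.\<close>

locale compact_conjugation = fd_lie_algebra scale bracket Basis
  for scale :: "complex \<Rightarrow> 'a::ab_group_add \<Rightarrow> 'a" and bracket and Basis +
  fixes conj :: "'a \<Rightarrow> 'a"
  assumes conj_add: "conj (x + y) = conj x + conj y"
    and conj_scale: "conj (scale c x) = scale (cnj c) (conj x)"
    and conj_conj [simp]: "conj (conj x) = x"
    and conj_bracket: "conj (bracket x y) = bracket (conj x) (conj y)"
    and killing_form_conj: "killing_form (conj x) (conj y) = cnj (killing_form x y)"
    and killing_form_neg: "x \<noteq> 0 \<Longrightarrow> Re (killing_form x (conj x)) < 0"
begin

interpretation endo: vector_space_pair scale scale ..

lemma conj_0 [simp]: "conj 0 = 0"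
  using conj_scale[of 0 0] by simp

lemma conj_minus: "conj (- x) = - conj x"
  using conj_scale[of "-1" x] by simp

lemma conj_diff: "conj (x - y) = conj x - conj y"
  using conj_add[of x "- y"] by (simp add: conj_minus)

lemma conj_sum: "conj (\<Sum>i\<in>I. f i) = (\<Sum>i\<in>I. conj (f i))"
  by (induction I rule: infinite_finite_induct) (auto simp: conj_add)

definition herm :: "'a \<Rightarrow> 'a \<Rightarrow> complex" where
  "herm x y = - killing_form x (conj y)"

lemma herm_add_left: "herm (x + y) z = herm x z + herm y z"
  by (simp add: herm_def killing_form_add_left)

lemma herm_scale_left: "herm (scale c x) y = c * herm x y"
  by (simp add: herm_def killing_form_scale_left)

lemma herm_scale_right: "herm x (scale c y) = cnj c * herm x y"
  by (simp add: herm_def conj_scale killing_form_scale_right)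

lemma herm_commute: "herm y x = cnj (herm x y)"
  using killing_form_conj[of x "conj y"] by (simp add: herm_def killing_form_sym)

lemma herm_zero_left [simp]: "herm 0 y = 0"
  using herm_scale_left[of 0 0 y] by simp

lemma herm_zero_right [simp]: "herm x 0 = 0"
  using herm_commute[of 0 x] by simp

lemma herm_diff_left: "herm (x - y) z = herm x z - herm y z"
  using herm_add_left[of "x - y" y z] by simp

lemma herm_self: "herm x x = of_real (Re (herm x x))"
  using herm_commute[of x x] by (simp add: complex_eq_iff)

lemma herm_self_pos: "x \<noteq> 0 \<Longrightarrow> 0 < Re (herm x x)"
  using killing_form_neg[of x] by (simp add: herm_def)

lemma herm_self_nonneg: "0 \<le> Re (herm x x)"
  using herm_self_pos[of x] by (cases "x = 0") auto

lemma herm_self_eq_0: "herm x x = 0 \<Longrightarrow> x = 0"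
  using herm_self_pos[of x] by force

lemma killing_form_nondegenerate: "(\<And>w. killing_form z w = 0) \<Longrightarrow> z = 0"
  by (rule herm_self_eq_0) (simp add: herm_def)

lemma herm_bracket_left: "herm (bracket x y) z = herm y (bracket (- conj x) z)"
proof -
  have "killing_form (bracket x y) (conj z) = - killing_form (bracket y x) (conj z)"
    using killing_form_scale_left[of "-1" "bracket y x" "conj z"] bracket_swap[of x y] by simp
  then show ?thesis
    using killing_form_scale_right[of y "-1"]
    by (simp add: herm_def killing_form_invariant conj_bracket conj_minus bracket_minus_left)
qed

lemma self_adjoint_eigenvalue_real:
  assumes "\<And>y z. herm (F y) z = herm y (F z)" "v \<in> eigenspace F c" "v \<noteq> 0"
  shows "cnj c = c"
proof -
  have "c * herm v v = cnj c * herm v v"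
    using assms(1)[of v v] assms(2) by (simp add: eigenspace_def herm_scale_left herm_scale_right)
  then show ?thesis using herm_self_pos[OF assms(3)] by auto
qed

text \<open>With \<open>W\<close> the span of the eigenvectors, the key is that
  \<open>F v - scale c v\<close> in \<open>W\<close> forces \<open>v\<close> in \<open>W\<close>,
  that is, there are no proper generalized eigenvectors. An annihilating polynomial of
  \<open>v\<close>, split into linear factors over the complex numbers, then reduces to the zero
  vector.\<close>

lemma self_adjoint_diagonalizable:
  assumes F: "Vector_Spaces.linear scale scale F" and adj: "\<And>y z. herm (F y) z = herm y (F z)"
  shows "diagonalizable F"
proof -
  define W where "W = span (\<Union>c. eigenspace F c)"
  have step: "v \<in> W" if w: "F v - scale c v \<in> W" for v c
  proof -
    from w have "F v - scale c v \<in> span (\<Union>c\<in>UNIV. eigenspace F c)" by (simp add: W_def)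
    then obtain \<Lambda> u where u: "finite \<Lambda>" "\<And>c. c \<in> \<Lambda> \<Longrightarrow> u c \<in> eigenspace F c"
      "F v - scale c v = (\<Sum>c\<in>\<Lambda>. u c)"
      using span_eigenvectors_decompose[OF F] by metis
    \<comment> \<open>\<open>F - c\<close> is invertible on the eigenspaces for \<open>d\<close>
      other than \<open>c\<close>; applied to \<open>v'\<close> it returns those components of
      \<open>F v - scale c v\<close>.\<close>
    define v' where "v' = (\<Sum>d\<in>\<Lambda> - {c}. scale (1 / (d - c)) (u d))"
    have Fu: "F (u d) = scale d (u d)" if "d \<in> \<Lambda>" for d
      using u(2)[OF that] by (simp add: eigenspace_def)
    have "F v' - scale c v' = (\<Sum>d\<in>\<Lambda> - {c}. scale (1 / (d - c)) (F (u d)) - scale c (scale (1 / (d - c)) (u d)))"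
      by (simp only: v'_def endo.linear_sum[OF F] endo.linear_scale[OF F] scale_sum_right sum_subtractf)
    also have "\<dots> = (\<Sum>d\<in>\<Lambda> - {c}. u d)"
    proof (rule sum.cong)
      fix d assume d: "d \<in> \<Lambda> - {c}"
      have "scale (1 / (d - c)) (F (u d)) - scale c (scale (1 / (d - c)) (u d)) =
          scale (1 / (d - c) * d - c * (1 / (d - c))) (u d)"
        using Fu d by (simp add: scale_left_diff_distrib)
      also have "1 / (d - c) * d - c * (1 / (d - c)) = (d - c) / (d - c)"
        by (simp only: diff_divide_distrib times_divide_eq_left times_divide_eq_right mult_1 mult_1_right)
      also have "\<dots> = 1" using d by simp
      finally show "scale (1 / (d - c)) (F (u d)) - scale c (scale (1 / (d - c)) (u d)) = u d" by simp
    qed simp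
    finally have v': "F v' - scale c v' = (\<Sum>d\<in>\<Lambda> - {c}. u d)" .
    define r where "r = F (v - v') - scale c (v - v')"
    have "r = (F v - scale c v) - (F v' - scale c v')"
      by (simp add: r_def endo.linear_diff[OF F] scale_right_diff_distrib)
    also have "\<dots> = (if c \<in> \<Lambda> then u c else 0)"
      unfolding u(3) v' using u(1) by (simp add: sum_diff1)
    finally have r: "F r = scale c r"
      using Fu[of c] endo.linear_0[OF F] by auto
    \<comment> \<open>\<open>r\<close> lies in the image and in the kernel of \<open>F - c\<close>.
      If it were nonzero, the eigenvalue \<open>c\<close> would be real, \<open>F - c\<close>
      self-adjoint, and \<open>r\<close> orthogonal to itself.\<close>
    have "r = 0"
    proof (rule ccontr)
      assume "r \<noteq> 0"
      have "cnj c = c"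
        using self_adjoint_eigenvalue_real[OF adj, of r c] r \<open>r \<noteq> 0\<close> by (simp add: eigenspace_def)
      then have "herm r r = 0"
        by (subst (1) r_def)
          (simp add: herm_diff_left adj herm_scale_left r herm_scale_right)
      then show False using herm_self_eq_0 \<open>r \<noteq> 0\<close> by blast
    qed
    then have "v - v' \<in> eigenspace F c" by (simp add: r_def eigenspace_def)
    then have "v - v' \<in> W" unfolding W_def by (intro span_base) auto
    moreover have "v' \<in> W"
      unfolding W_def v'_def using u(2) by (intro span_sum span_scale span_base) auto
    ultimately have "(v - v') + v' \<in> W" unfolding W_def by (rule span_add)
    then show ?thesis by simp
  qed
  \<comment> \<open>Induction on the degree: a complex root \<open>c\<close> of \<open>p\<close>
    splits off a factor, the quotient \<open>q\<close> annihilates \<open>F v - scale c v\<close>,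
    and \<open>step\<close> leads back to \<open>v\<close>.\<close>
  have ann: "v \<in> W" if "p \<noteq> 0" "degree p = N" "(\<Sum>i\<le>N. scale (coeff p i) ((F ^^ i) v)) = 0" for p N v
    using that
  proof (induction N arbitrary: p v)
    case 0
    have "coeff p 0 \<noteq> 0" using 0(1,2) leading_coeff_neq_0 by metis
    then have "v = 0" using 0(3) by simp
    then show ?case unfolding W_def by (simp add: span_zero)
  next
    case (Suc N)
    have "\<not> constant (poly p)" using Suc.prems(2) by (simp add: constant_degree)
    then obtain c where "poly p c = 0" using fundamental_theorem_of_algebra by blast
    then obtain q where q: "p = [:- c, 1:] * q" by (auto simp: poly_eq_0_iff_dvd)
    have "q \<noteq> 0" using Suc.prems(1) q by auto
    have "degree p = degree [:- c, 1:] + degree q"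
      unfolding q using \<open>q \<noteq> 0\<close> by (intro degree_mult_eq) auto
    then have "degree q = N" using Suc.prems(2) by simp
    have lin: "Vector_Spaces.linear scale scale (F ^^ i)" for i
    proof (induction i)
      case 0
      show ?case using linear_id by (simp add: id_def)
    next
      case (Suc i)
      show ?case unfolding funpow.simps by (rule Vector_Spaces.linear_compose[OF Suc F])
    qed
    have cp: "coeff p i = (case i of 0 \<Rightarrow> 0 | Suc j \<Rightarrow> coeff q j) - c * coeff q i" for i
      unfolding q by (simp add: coeff_pCons split: nat.split)
    have top: "coeff q (Suc N) = 0" using \<open>degree q = N\<close> by (simp add: coeff_eq_0)
    have "(\<Sum>i\<le>Suc N. scale (coeff p i) ((F ^^ i) v)) =
        (\<Sum>i\<le>Suc N. scale (case i of 0 \<Rightarrow> 0 | Suc j \<Rightarrow> coeff q j) ((F ^^ i) v))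
        - (\<Sum>i\<le>Suc N. scale (c * coeff q i) ((F ^^ i) v))"
      by (simp only: cp scale_left_diff_distrib sum_subtractf)
    also have "(\<Sum>i\<le>Suc N. scale (case i of 0 \<Rightarrow> 0 | Suc j \<Rightarrow> coeff q j) ((F ^^ i) v)) =
        (\<Sum>i\<le>N. scale (coeff q i) ((F ^^ i) (F v)))"
      by (subst sum.atMost_Suc_shift) (simp add: funpow_swap1)
    also have "(\<Sum>i\<le>Suc N. scale (c * coeff q i) ((F ^^ i) v)) =
        (\<Sum>i\<le>N. scale (coeff q i) ((F ^^ i) (scale c v)))"
      by (simp add: top endo.linear_scale[OF lin] mult.commute)
    finally have "(\<Sum>i\<le>N. scale (coeff q i) ((F ^^ i) (F v - scale c v))) = 0"
      using Suc.prems(3) by (simp add: endo.linear_diff[OF lin] scale_right_diff_distrib sum_subtractf)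
    then have "F v - scale c v \<in> W" by (rule Suc.IH[OF \<open>q \<noteq> 0\<close> \<open>degree q = N\<close>])
    then show ?case by (rule step)
  qed
  have "v \<in> W" for v
  proof -
    \<comment> \<open>The \<open>?n + 1\<close> iterates of \<open>v\<close> are dependent; the
      coefficients of a relation are those of an annihilating polynomial.\<close>
    let ?n = "dim UNIV"
    have "\<not> independent_family {..?n} (\<lambda>i. (F ^^ i) v)"
      using independent_family_card_le_dim[of "{..?n}" "\<lambda>i. (F ^^ i) v" UNIV] by auto
    then obtain a j where a: "(\<Sum>i\<le>?n. scale (a i) ((F ^^ i) v)) = 0" "j \<le> ?n" "a j \<noteq> 0"
      unfolding independent_family_def by auto
    define p where "p = (\<Sum>i\<le>?n. monom (a i) i)"
    have cp: "coeff p i = (if i \<le> ?n then a i else 0)" for i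
      by (simp add: p_def coeff_sum)
    have "coeff p j \<noteq> 0" using cp a by simp
    then have p0: "p \<noteq> 0" by auto
    have deg: "degree p \<le> ?n" by (rule degree_le) (simp add: cp)
    have "(\<Sum>i\<le>degree p. scale (coeff p i) ((F ^^ i) v)) = (\<Sum>i\<le>?n. scale (coeff p i) ((F ^^ i) v))"
      using deg by (intro sum.mono_neutral_left) (auto simp: coeff_eq_0)
    also have "\<dots> = (\<Sum>i\<le>?n. scale (a i) ((F ^^ i) v))"
      by (rule sum.cong) (simp_all add: cp)
    finally have "(\<Sum>i\<le>degree p. scale (coeff p i) ((F ^^ i) v)) = 0" using a(1) by simp
    then show ?thesis using ann[OF p0 refl] by blast
  qed
  then show ?thesis by (auto simp: diagonalizable_iff W_def)
qed

lemma herm_bracket_imaginary: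
  assumes "conj a = - a"
  shows "herm (bracket a y) z = herm y (bracket a z)"
  using herm_bracket_left[of a y z] assms by simp

lemma diagonalizable_bracket_imaginary: "conj a = - a \<Longrightarrow> diagonalizable (bracket a)"
  by (rule self_adjoint_diagonalizable[OF linear_bracket herm_bracket_imaginary])

text \<open>With respect to \<open>herm\<close>, \<open>ad e\<close> and \<open>ad f\<close> are adjoint. So \<open>ad e\<close> has no kernel on negative
  weight spaces and \<open>ad f\<close> none on the span \<open>X\<close> of the positive ones, and the kernel of \<open>ad e\<close> meets
  \<open>ad f X\<close> trivially; as all weights are even, both lie in the span of the nonnegative weight spaces.\<close>

lemma sl2_even_weights:
  assumes conj_h: "conj h = - h" and f: "f = - conj e" and he: "bracket h e = scale 2 e"
    and ef: "bracket e f = h"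
    and even: "span (\<Union>k. eigenspace (bracket h) (of_int (2 * k))) = UNIV"
  shows "nilpotent_element e" "dim (centralizer e) \<le> dim (eigenspace (bracket h) 0)"
proof -
  interpret fe: finite_dimensional_vector_space_pair scale Basis scale Basis ..
  define V where "V k = eigenspace (bracket h) (of_int (2 * k))" for k
  have Vsub: "subspace (V k)" for k unfolding V_def by (rule subspace_eigenspace[OF linear_bracket])
  have hf: "bracket h f = scale (-2) f"
    using arg_cong[OF he, of conj] conj_h
    by (simp add: f conj_bracket conj_scale bracket_minus_left bracket_minus_right)
  have eV: "bracket e u \<in> V (k + 1)" if "u \<in> V k" for u k
    using that bracket_bracket_left[of h e u]
    by (simp add: V_def eigenspace_def he bracket_scale_left bracket_scale_right scale_left_distrib
        algebra_simps)
  have fV: "bracket f u \<in> V (k - 1)" if "u \<in> V k" for u k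
    using that bracket_bracket_left[of h f u]
    by (simp add: V_def eigenspace_def hf bracket_scale_left bracket_scale_right scale_left_diff_distrib
        bracket_minus_left algebra_simps)
  have adj_e: "herm (bracket e x) y = herm x (bracket f y)" for x y
    using herm_bracket_left[of e x y] by (simp add: f)
  have adj_f: "herm (bracket f x) y = herm x (bracket e y)" for x y
    using herm_bracket_left[of f x y] by (simp add: f conj_minus)
  show "nilpotent_element e"
  proof -
    define K where "K = {k. V k \<noteq> {0}}"
    have "(\<lambda>k. of_int (2 * k)) ` K \<subseteq> spectrum (bracket h)"
    proof
      fix c :: complex assume "c \<in> (\<lambda>k. of_int (2 * k)) ` K"
      then obtain k where k: "k \<in> K" "c = of_int (2 * k)" by blast
      then have "V k \<noteq> {0}" by (simp add: K_def)
      then obtain u where "u \<in> V k" "u \<noteq> 0" using subspace_0[OF Vsub, of k] by blast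
      then show "c \<in> spectrum (bracket h)" using k by (auto simp: spectrum_def V_def)
    qed
    then have "finite ((\<lambda>k. of_int (2 * k) :: complex) ` K)"
      using finite_spectrum[OF linear_bracket] finite_subset by blast
    then have finK: "finite K" by (rule finite_imageD) (auto simp: inj_on_def)
    obtain M where M: "\<And>k. k \<in> K \<Longrightarrow> \<bar>k\<bar> \<le> M"
      using that[of "Max (abs ` K)"] finK by simp
    \<comment> \<open>Each application of \<open>e\<close> raises the index by one and all occurring
      indices lie between \<open>- M\<close> and \<open>M\<close>, so \<open>2 M + 1\<close>
      applications leave this range.\<close>
    define n where "n = nat (2 * \<bar>M\<bar> + 1)"
    have pow: "(bracket e ^^ m) u \<in> V (k + int m)" if "u \<in> V k" for u k m
      using that by (induction m) (auto dest: eV simp: algebra_simps)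
    have "(bracket e ^^ n) u = 0" if "u \<in> V k" for u k
    proof (cases "k \<in> K")
      case True
      have "k + int n \<notin> K"
      proof
        assume "k + int n \<in> K"
        then show False using M[OF True] M[of "k + int n"] by (simp add: n_def)
      qed
      then show ?thesis using pow[OF that] by (auto simp: K_def)
    next
      case False
      then have "u = 0" using that by (auto simp: K_def)
      then show ?thesis by (simp add: endo.linear_0[OF linear_bracket_power])
    qed
    then have "(\<Union>k. V k) \<subseteq> {u. (bracket e ^^ n) u = 0}" by auto
    then have "span (\<Union>k. V k) \<subseteq> {u. (bracket e ^^ n) u = 0}"
      by (rule span_minimal) (rule endo.linear_subspace_kernel[OF linear_bracket_power])
    then show ?thesis using even unfolding nilpotent_element_def V_def by blast
  qed
  \<comment> \<open>If \<open>e\<close> kills \<open>u\<close>, then \<open>[e, f] = h\<close> gives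
    \<open>e f u = 2 k u\<close>. By adjointness the square norm of \<open>f u\<close> is
    \<open>2 k\<close> times that of \<open>u\<close>, which is impossible for negative
    \<open>k\<close> unless \<open>u = 0\<close>.\<close>
  have V_zero: "u = 0" if u: "u \<in> V k" and k: "k < 0" "bracket e u = 0" for u k
  proof -
    have eq: "bracket e (bracket f u) = scale (of_int (2 * k)) u"
      using bracket_bracket_left[of e f u] u k by (simp add: ef V_def eigenspace_def)
    have "herm (bracket f u) (bracket f u) = of_int (2 * k) * herm u u"
      by (simp only: adj_f eq) (simp add: herm_scale_right)
    then have "Re (herm (bracket f u) (bracket f u)) = 2 * of_int k * Re (herm u u)" by simp
    moreover have "2 * of_int k * Re (herm u u) < 0" if "u \<noteq> 0"
      using herm_self_pos[OF that] k by (simp add: mult_neg_pos)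
    ultimately show ?thesis using herm_self_nonneg[of "bracket f u"] by force
  qed
  have V_zero': "u = 0" if u: "u \<in> V k" and k: "0 < k" "bracket f u = 0" for u k
  proof -
    have "- bracket f (bracket e u) = scale (of_int (2 * k)) u"
      using bracket_bracket_left[of e f u] u k by (simp add: ef V_def eigenspace_def)
    then have eq: "bracket f (bracket e u) = scale (- of_int (2 * k)) u"
      by (metis minus_minus scale_minus_left)
    have "herm (bracket e u) (bracket e u) = - of_int (2 * k) * herm u u"
      by (simp only: adj_e eq herm_scale_right) simp
    then have "Re (herm (bracket e u) (bracket e u)) = - 2 * of_int k * Re (herm u u)" by simp
    moreover have "- 2 * of_int k * Re (herm u u) < 0" if "u \<noteq> 0"
      using herm_self_pos[OF that] k by simp
    ultimately show ?thesis using herm_self_nonneg[of "bracket e u"] by force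
  qed
  \<comment> \<open>The count will be
    \<open>dim (centralizer e) + dim X <= dim Y <= dim (V 0) + dim X\<close>, where
    \<open>dim X\<close> on the left is the dimension of its image under the injective
    \<open>bracket f\<close>.\<close>
  define X where "X = span (\<Union>k\<in>{0<..}. V k)"
  define Y where "Y = span (\<Union>k\<in>{0..}. V k)"
  have X_sub: "subspace X" and spanX: "span X = X" unfolding X_def by (simp_all add: span_span)
  have VY: "V k \<subseteq> Y" if "0 \<le> k" for k unfolding Y_def using that by (auto intro: span_base)
  have C_Y: "centralizer e \<subseteq> Y"
  proof
    fix v assume v: "v \<in> centralizer e"
    have inv: "bracket h w \<in> centralizer e" if "w \<in> centralizer e" for w
      using that by (simp add: centralizer_def bracket_bracket_left he bracket_scale_right)
    have "v \<in> span (\<Union>c\<in>range (\<lambda>k. of_int (2 * k)). eigenspace (bracket h) c)"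
      using even by (simp add: image_image)
    then obtain \<Lambda> u where u: "finite \<Lambda>" "\<Lambda> \<subseteq> range (\<lambda>k. of_int (2 * k))"
      "\<And>c. c \<in> \<Lambda> \<Longrightarrow> u c \<in> eigenspace (bracket h) c" "v = (\<Sum>c\<in>\<Lambda>. u c)"
      using span_eigenvectors_decompose[OF linear_bracket] by metis
    have "u c \<in> Y" if c: "c \<in> \<Lambda>" for c
    proof -
      obtain k where k: "c = of_int (2 * k)" using u(2) c by blast
      have uV: "u c \<in> V k" using u(3)[OF c] k by (simp add: V_def)
      have "u c \<in> centralizer e"
        using eigen_component_mem[OF linear_bracket subspace_centralizer inv u(1,3) _ c] v u(4) by simp
      then have "bracket e (u c) = 0" using bracket_swap[of e "u c"] by (simp add: centralizer_def)
      then have "0 \<le> k \<or> u c = 0" using V_zero[OF uV] by force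
      then show ?thesis using VY[of k] uV unfolding Y_def by (auto simp: span_zero)
    qed
    then show "v \<in> Y" unfolding u(4) Y_def by (rule span_sum)
  qed
  have f_Y: "bracket f ` X \<subseteq> Y"
  proof -
    have "X \<subseteq> {x. bracket f x \<in> Y}"
      unfolding X_def
    proof (rule span_minimal)
      show "(\<Union>k\<in>{0<..}. V k) \<subseteq> {x. bracket f x \<in> Y}"
      proof
        fix x assume "x \<in> (\<Union>k\<in>{0<..}. V k)"
        then obtain k where k: "0 < k" "x \<in> V k" by auto
        then show "x \<in> {x. bracket f x \<in> Y}" using fV[OF k(2)] VY[of "k - 1"] by auto
      qed
      show "subspace {x. bracket f x \<in> Y}"
        unfolding Y_def by (rule endo.linear_subspace_linear_preimage[OF linear_bracket subspace_span])
    qed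
    then show ?thesis by blast
  qed
  have f_inj: "x = 0" if x: "x \<in> X" "bracket f x = 0" for x
  proof -
    have inv: "bracket h w \<in> {w. bracket f w = 0}" if "w \<in> {w. bracket f w = 0}" for w
    proof -
      have "bracket f (bracket h w) = bracket h (bracket f w) - bracket (bracket h f) w"
        by (simp add: bracket_bracket_left)
      then show ?thesis using that by (simp add: hf bracket_scale_left bracket_minus_left)
    qed
    have "x \<in> span (\<Union>c\<in>(\<lambda>k. of_int (2 * k)) ` {0<..}. eigenspace (bracket h) c)"
      using x(1) by (simp add: X_def V_def image_image)
    then obtain \<Lambda> u where u: "finite \<Lambda>" "\<Lambda> \<subseteq> (\<lambda>k. of_int (2 * k)) ` {0<..}"
      "\<And>c. c \<in> \<Lambda> \<Longrightarrow> u c \<in> eigenspace (bracket h) c" "x = (\<Sum>c\<in>\<Lambda>. u c)"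
      using span_eigenvectors_decompose[OF linear_bracket] by metis
    have "u c = 0" if c: "c \<in> \<Lambda>" for c
    proof -
      obtain k where k: "c = of_int (2 * k)" "0 < k" using u(2) c by auto
      have uV: "u c \<in> V k" using u(3)[OF c] k by (simp add: V_def)
      have "u c \<in> {w. bracket f w = 0}"
        using eigen_component_mem[OF linear_bracket
            endo.linear_subspace_kernel[OF linear_bracket, of f] inv u(1,3) _ c] x(2) u(4) by simp
      then show ?thesis using V_zero'[OF uV k(2)] by simp
    qed
    then show ?thesis using u(4) by simp
  qed
  have "centralizer e \<inter> bracket f ` X \<subseteq> {0}"
  proof clarify
    fix x assume "x \<in> X" "bracket f x \<in> centralizer e"
    then have "bracket e (bracket f x) = 0"
      using bracket_swap[of e] by (simp add: centralizer_def)
    then have "herm (bracket f x) (bracket f x) = 0" by (simp add: adj_f)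
    then show "bracket f x = 0" by (rule herm_self_eq_0)
  qed
  then have "dim (centralizer e) + dim (bracket f ` X) \<le> dim Y"
    using C_Y f_Y endo.linear_subspace_image[OF linear_bracket, of X f]
    by (intro dim_add_le subspace_centralizer) (auto simp: X_def)
  moreover have "dim (bracket f ` X) = dim X"
  proof (rule fe.dim_image_eq[OF linear_bracket])
    show "inj_on (bracket f) (span X)"
      unfolding spanX using f_inj X_sub by (subst endo.linear_inj_on_iff_eq_0[OF linear_bracket]) auto
  qed
  moreover have "Y = span (V 0 \<union> (\<Union>k\<in>{0<..}. V k))"
  proof -
    have "{0..} = insert (0::int) {0<..}" by auto
    then show ?thesis unfolding Y_def by (metis UN_insert)
  qed
  moreover have "dim (span (V 0 \<union> (\<Union>k\<in>{0<..}. V k))) \<le> dim (V 0) + dim (\<Union>k\<in>{0<..}. V k)"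
    by (rule dim_span_Un_le)
  moreover have "dim X = dim (\<Union>k\<in>{0<..}. V k)" by (simp add: X_def)
  ultimately show "dim (centralizer e) \<le> dim (eigenspace (bracket h) 0)"
    by (simp add: V_def)
qed

end

section \<open>Roots of a compact conjugation\<close>

text \<open>\<open>A\<close> is i times a maximal abelian subalgebra of the compact real form.
  Maximality is phrased for single elements; closure under sums and real multiples is derived from
  it.\<close>

locale maximal_imaginary_abelian = compact_conjugation scale bracket Basis conj
  for scale :: "complex \<Rightarrow> 'a::ab_group_add \<Rightarrow> 'a" and bracket and Basis and conj +
  fixes A :: "'a set"
  assumes conj_A: "a \<in> A \<Longrightarrow> conj a = - a"
    and commute_A: "a \<in> A \<Longrightarrow> b \<in> A \<Longrightarrow> bracket a b = 0"
    and maximal_A: "conj a = - a \<Longrightarrow> (\<And>b. b \<in> A \<Longrightarrow> bracket a b = 0) \<Longrightarrow> a \<in> A"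

lemma (in compact_conjugation) exists_maximal_imaginary_abelian:
  obtains A where "maximal_imaginary_abelian scale bracket Basis conj A"
proof -
  define \<A> where "\<A> = {A. (\<forall>a\<in>A. conj a = - a) \<and> (\<forall>a\<in>A. \<forall>b\<in>A. bracket a b = 0)}"
  have "\<Union>C \<in> \<A>" if "subset.chain \<A> C" for C
  proof -
    have C: "\<And>X. X \<in> C \<Longrightarrow> X \<in> \<A>" "\<And>X Y. X \<in> C \<Longrightarrow> Y \<in> C \<Longrightarrow> X \<subseteq> Y \<or> Y \<subseteq> X"
      using that unfolding subset_chain_def by auto
    have "bracket a b = 0" if "X \<in> C" "Y \<in> C" "a \<in> X" "b \<in> Y" for X Y a b
      using C(1)[OF that(1)] C(1)[OF that(2)] C(2)[OF that(1,2)] that(3,4) unfolding \<A>_def by blast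
    moreover have "conj a = - a" if "X \<in> C" "a \<in> X" for X a
      using C(1)[OF that(1)] that(2) unfolding \<A>_def by blast
    ultimately show ?thesis unfolding \<A>_def by blast
  qed
  then obtain A where A: "A \<in> \<A>" "\<And>X. X \<in> \<A> \<Longrightarrow> A \<subseteq> X \<Longrightarrow> X = A"
    using subset_Zorn'[of \<A>] by metis
  have "a \<in> A" if a: "conj a = - a" "\<And>b. b \<in> A \<Longrightarrow> bracket a b = 0" for a
  proof -
    have "bracket b a = 0" if "b \<in> A" for b using a(2)[OF that] bracket_swap[of b a] by simp
    then have "insert a A \<in> \<A>" using A(1) a unfolding \<A>_def by (auto simp: bracket_self)
    then show ?thesis using A(2) by blast
  qed
  then have "maximal_imaginary_abelian scale bracket Basis conj A"
    using A(1) unfolding \<A>_def by unfold_locales auto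
  then show ?thesis by (rule that)
qed

context maximal_imaginary_abelian
begin

interpretation endo: vector_space_pair scale scale ..

section \<open>The real vector space \<open>A\<close> and its complexification\<close>

lemma A_add: "a \<in> A \<Longrightarrow> b \<in> A \<Longrightarrow> a + b \<in> A"
  by (rule maximal_A) (simp_all add: conj_add conj_A bracket_add_left commute_A)

lemma A_scale: "a \<in> A \<Longrightarrow> scale (of_real r) a \<in> A"
  by (rule maximal_A) (simp_all add: conj_scale conj_A bracket_scale_left commute_A)

lemma A_zero: "0 \<in> A"
  by (rule maximal_A) simp_all

lemma A_diff: "a \<in> A \<Longrightarrow> b \<in> A \<Longrightarrow> a - b \<in> A"
  using A_add[of a "scale (of_real (-1)) b"] A_scale[of b "-1"] by simp

lemma A_sum: "(\<And>i. i \<in> I \<Longrightarrow> f i \<in> A) \<Longrightarrow> (\<Sum>i\<in>I. f i) \<in> A"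
  by (induction I rule: infinite_finite_induct) (auto simp: A_zero A_add)

definition torus :: "'a set" where
  "torus = {x. \<forall>a\<in>A. bracket x a = 0}"

text \<open>Since \<open>conj\<close> is -1 on \<open>A\<close>, it preserves the centralizer of
  \<open>A\<close>. So the imaginary part \<open>(x - conj x)/2\<close> and
  \<open>- i/2 (x + conj x)\<close> again centralize \<open>A\<close>, and maximality puts both into
  \<open>A\<close>.\<close>

lemma torus_decompose:
  assumes x: "x \<in> torus"
  obtains a b where "a \<in> A" "b \<in> A" "x = a + scale \<i> b"
proof -
  have cx: "bracket (conj x) a = 0" if "a \<in> A" for a
  proof -
    have "conj (bracket x a) = 0" using x that by (simp add: torus_def)
    then show ?thesis using that by (simp add: conj_bracket conj_A bracket_minus_right)
  qed
  have xa: "bracket x a = 0" if "a \<in> A" for a using x that by (simp add: torus_def)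
  have "scale (1/2) (x - conj x) \<in> A"
    by (rule maximal_A)
      (auto simp: conj_scale conj_diff bracket_scale_left bracket_diff_left cx xa
        scale_right_diff_distrib)
  moreover have "scale (- \<i>/2) (x + conj x) \<in> A"
  proof (rule maximal_A)
    show "conj (scale (- \<i>/2) (x + conj x)) = - scale (- \<i>/2) (x + conj x)"
      unfolding conj_scale conj_add conj_conj scale_minus_left[symmetric] by (simp add: add.commute)
    show "bracket (scale (- \<i>/2) (x + conj x)) b = 0" if "b \<in> A" for b
      unfolding bracket_scale_left bracket_add_left cx[OF that] xa[OF that] by simp
  qed
  moreover have "x = scale (1/2) (x - conj x) + scale \<i> (scale (- \<i>/2) (x + conj x))"
    by (simp add: scale_right_diff_distrib scale_right_distrib scale_left_distrib[symmetric] flip: add.assoc)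
  ultimately show ?thesis by (rule that)
qed

lemma A_subset_torus: "A \<subseteq> torus"
  by (auto simp: torus_def commute_A)

lemma cartan_torus: "cartan_subalgebra torus"
  unfolding cartan_subalgebra_def
proof (intro conjI ballI allI impI)
  show "subspace torus"
    unfolding torus_def subspace_def by (auto simp: bracket_add_left bracket_scale_left)
  show "bracket x y = 0" if x: "x \<in> torus" and y: "y \<in> torus" for x y
  proof -
    obtain a b where "a \<in> A" "b \<in> A" "y = a + scale \<i> b" using torus_decompose[OF y] .
    then show ?thesis using x by (simp add: torus_def bracket_add_right bracket_scale_right)
  qed
  show "x \<in> torus" if "\<forall>y\<in>torus. bracket x y = 0" for x
    using that A_subset_torus by (auto simp: torus_def)
  show "diagonalizable (bracket x)" if x: "x \<in> torus" for x
  proof -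
    \<comment> \<open>\<open>a\<close> and \<open>b\<close> commute and are both diagonalizable; a
      common eigenvector with eigenvalues \<open>c\<close> and \<open>d\<close> is an eigenvector of
      \<open>x\<close> for \<open>c + i d\<close>.\<close>
    obtain a b where ab: "a \<in> A" "b \<in> A" "x = a + scale \<i> b" using torus_decompose[OF x] .
    have comm: "bracket b (bracket a v) = bracket a (bracket b v)" for v
      using bracket_bracket_left[of b a v] commute_A[OF ab(2,1)] by simp
    have inv: "bracket b v \<in> eigenspace (bracket a) c" if "v \<in> eigenspace (bracket a) c" for v c
      using that comm[of v] by (simp add: eigenspace_def bracket_scale_right)
    let ?S = "span (\<Union>c. eigenspace (bracket x) c)"
    have 1: "v \<in> ?S" if v: "v \<in> eigenspace (bracket a) c" for v c
    proof -
      obtain \<Lambda> u where u: "\<And>d. d \<in> \<Lambda> \<Longrightarrow> u d \<in> eigenspace (bracket b) d"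
        "\<And>d. d \<in> \<Lambda> \<Longrightarrow> u d \<in> eigenspace (bracket a) c" "v = (\<Sum>d\<in>\<Lambda>. u d)"
        using diagonalizable_decompose[OF linear_bracket subspace_eigenspace[OF linear_bracket] inv
            diagonalizable_bracket_imaginary[OF conj_A[OF ab(2)]] v] by blast
      have "u d \<in> eigenspace (bracket x) (c + \<i> * d)" if "d \<in> \<Lambda>" for d
        using u(1,2)[OF that]
        by (simp add: eigenspace_def ab(3) bracket_add_left bracket_scale_left scale_left_distrib)
      then show ?thesis unfolding u(3) by (intro span_sum span_base) blast
    qed
    have "v \<in> ?S" for v
    proof -
      obtain \<Lambda> u where u: "\<And>d. d \<in> \<Lambda> \<Longrightarrow> u d \<in> eigenspace (bracket a) d" "v = (\<Sum>d\<in>\<Lambda>. u d)"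
        using diagonalizable_decompose[OF linear_bracket subspace_UNIV _
            diagonalizable_bracket_imaginary[OF conj_A[OF ab(1)]], of v] by blast
      then show ?thesis unfolding u(2) by (intro span_sum) (rule 1)
    qed
    then show ?thesis by (auto simp: diagonalizable_iff)
  qed
qed

text \<open>On \<open>A\<close> the Killing form is real, and positive definite because
  \<open>conj\<close> acts as -1 there; this is the resulting Euclidean inner product.\<close>

definition form :: "'a \<Rightarrow> 'a \<Rightarrow> real" where
  "form a b = Re (killing_form a b)"

lemma killing_form_A: "a \<in> A \<Longrightarrow> b \<in> A \<Longrightarrow> killing_form a b = of_real (form a b)"
  using killing_form_conj[of a b] killing_form_scale_left[of "-1"] killing_form_scale_right[of _ "-1"]
  by (simp add: conj_A form_def complex_eq_iff)

lemma form_sym: "form a b = form b a"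
  by (simp add: form_def killing_form_sym)

lemma form_add_left: "form (a + b) c = form a c + form b c"
  by (simp add: form_def killing_form_add_left)

lemma form_scale_left: "form (scale (of_real r) a) b = r * form a b"
  by (simp add: form_def killing_form_scale_left)

lemma form_diff_left: "form (a - b) c = form a c - form b c"
  using form_add_left[of "a - b" b c] by simp

lemma form_sum_left: "form (\<Sum>i\<in>I. f i) c = (\<Sum>i\<in>I. form (f i) c)"
  by (simp add: form_def killing_form_sum_left)

lemma form_add_right: "form c (a + b) = form c a + form c b"
  by (simp add: form_sym[of c] form_add_left)

lemma form_scale_right: "form b (scale (of_real r) a) = r * form b a"
  by (simp add: form_sym[of b] form_scale_left)

lemma form_diff_right: "form c (a - b) = form c a - form c b"
  by (simp add: form_sym[of c] form_diff_left)

lemma form_pos: "a \<in> A \<Longrightarrow> a \<noteq> 0 \<Longrightarrow> 0 < form a a"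
  using killing_form_neg[of a] killing_form_scale_right[of a "-1" a] by (simp add: conj_A form_def)

lemma A_eqI:
  assumes "a \<in> A" "b \<in> A" "\<And>c. c \<in> A \<Longrightarrow> form c a = form c b"
  shows "a = b"
  using form_pos[of "a - b"] assms(3)[OF A_diff[OF assms(1,2)]] A_diff[OF assms(1,2)]
  by (auto simp: form_diff_right)

text \<open>Induction step: project the other vectors to the orthogonal complement of \<open>\<tau> n\<close>. This keeps the
  angles obtuse, and it increases both the right-hand sides and the products with \<open>x\<close>.\<close>

lemma obtuse_system_solution:
  assumes "finite I" "x \<in> A" "\<And>i. i \<in> I \<Longrightarrow> \<tau> i \<in> A" "\<And>i. i \<in> I \<Longrightarrow> 0 < form x (\<tau> i)"
    and "\<And>i j. i \<in> I \<Longrightarrow> j \<in> I \<Longrightarrow> i \<noteq> j \<Longrightarrow> form (\<tau> i) (\<tau> j) \<le> 0"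
    and "\<And>i. i \<in> I \<Longrightarrow> 0 < d i"
  shows "\<exists>c::'i \<Rightarrow> real. \<forall>i\<in>I. 0 \<le> c i \<and> (\<Sum>j\<in>I. c j * form (\<tau> j) (\<tau> i)) = d i"
  using assms
proof (induction I arbitrary: \<tau> d rule: finite_induct)
  case empty
  then show ?case by simp
next
  case (insert n I)
  define g where "g i = form (\<tau> i) (\<tau> n) / form (\<tau> n) (\<tau> n)" for i
  \<comment> \<open>The half space enters here: it keeps the pivot nonzero, and the projected
    vectors remain in it.\<close>
  have "\<tau> n \<noteq> 0"
  proof
    assume "\<tau> n = 0"
    then have "form x (\<tau> n) = 0" using form_diff_right[of x 0 0] by simp
    then show False using insert.prems(3)[of n] by simp
  qed
  then have pos: "0 < form (\<tau> n) (\<tau> n)" using insert.prems(2) by (intro form_pos) auto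
  have g: "g i \<le> 0" if "i \<in> I" for i
    unfolding g_def using insert.prems(4)[of i n] insert.hyps that pos
    by (intro divide_nonpos_pos) auto
  have gn: "g i * form (\<tau> n) (\<tau> n) = form (\<tau> i) (\<tau> n)" for i
    using pos by (simp add: g_def)
  define \<tau>' where "\<tau>' i = \<tau> i - scale (of_real (g i)) (\<tau> n)" for i
  define d' where "d' i = d i - g i * d n" for i
  have form': "form (\<tau>' i) (\<tau>' j) = form (\<tau> i) (\<tau> j) - g i * form (\<tau> j) (\<tau> n)" for i j
  proof -
    have "form (\<tau>' i) (\<tau>' j) = form (\<tau> i) (\<tau> j) - g i * form (\<tau> n) (\<tau> j)
        - g j * (form (\<tau> i) (\<tau> n) - g i * form (\<tau> n) (\<tau> n))"
      unfolding \<tau>'_def form_diff_left form_diff_right form_scale_left form_scale_right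
      by (simp add: algebra_simps)
    then show ?thesis by (simp add: gn form_sym[of "\<tau> n" "\<tau> j"])
  qed
  have "\<exists>c. \<forall>i\<in>I. 0 \<le> c i \<and> (\<Sum>j\<in>I. c j * form (\<tau>' j) (\<tau>' i)) = d' i"
  proof (rule insert.IH[OF insert.prems(1)])
    fix i assume i: "i \<in> I"
    show "\<tau>' i \<in> A" unfolding \<tau>'_def using insert.prems(2) i by (intro A_diff A_scale) auto
    have "g i * form x (\<tau> n) \<le> 0" using g[OF i] insert.prems(3)[of n] by (simp add: mult_nonpos_nonneg)
    then show "0 < form x (\<tau>' i)"
      using insert.prems(3)[of i] i by (simp add: \<tau>'_def form_diff_right form_scale_right)
    have "g i * d n \<le> 0" using g[OF i] insert.prems(5)[of n] by (simp add: mult_nonpos_nonneg)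
    then show "0 < d' i" using insert.prems(5)[of i] i by (simp add: d'_def)
    fix j assume j: "j \<in> I" "i \<noteq> j"
    have "0 \<le> g i * form (\<tau> j) (\<tau> n)"
      using g[OF i] insert.prems(4)[of j n] insert.hyps j by (intro mult_nonpos_nonpos) auto
    then show "form (\<tau>' i) (\<tau>' j) \<le> 0" unfolding form' using insert.prems(4)[of i j] i j by simp
  qed
  then obtain c where c: "\<And>i. i \<in> I \<Longrightarrow> 0 \<le> c i"
    "\<And>i. i \<in> I \<Longrightarrow> (\<Sum>j\<in>I. c j * form (\<tau>' j) (\<tau>' i)) = d' i" by blast
  define s where "s = (\<Sum>j\<in>I. c j * form (\<tau> j) (\<tau> n))"
  \<comment> \<open>Solves the equation for \<open>n\<close> with the other coefficients kept;
    obtuseness gives \<open>s <= 0\<close> and hence \<open>cn >= 0\<close>. The equation for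
    \<open>i\<close> in \<open>I\<close> is the projected one plus \<open>g i\<close> times the one
    for \<open>n\<close>.\<close>
  define cn where "cn = (d n - s) / form (\<tau> n) (\<tau> n)"
  let ?c = "\<lambda>i. if i = n then cn else c i"
  have "s \<le> 0"
    unfolding s_def using c(1) insert.prems(4)[of _ n] insert.hyps
    by (intro sum_nonpos mult_nonneg_nonpos) auto
  then have "0 \<le> cn" unfolding cn_def using insert.prems(5)[of n] pos by (intro divide_nonneg_pos) auto
  have sum: "(\<Sum>j\<in>insert n I. ?c j * form (\<tau> j) (\<tau> i)) =
      cn * form (\<tau> n) (\<tau> i) + (\<Sum>j\<in>I. c j * form (\<tau> j) (\<tau> i))" for i
    using insert.hyps by (auto intro!: sum.cong)
  have "(\<Sum>j\<in>insert n I. ?c j * form (\<tau> j) (\<tau> i)) = d i" if "i \<in> insert n I" for i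
  proof (cases "i = n")
    case True
    then show ?thesis using pos by (simp only: sum) (simp add: s_def[symmetric] cn_def)
  next
    case False
    then have i: "i \<in> I" using that by simp
    have "d' i = (\<Sum>j\<in>I. c j * (form (\<tau> j) (\<tau> i) - g i * form (\<tau> j) (\<tau> n)))"
      unfolding c(2)[OF i, symmetric] form' by (rule sum.cong) (simp_all add: g_def mult.commute)
    also have "\<dots> = (\<Sum>j\<in>I. c j * form (\<tau> j) (\<tau> i)) - g i * s"
      by (simp add: s_def right_diff_distrib sum_subtractf sum_distrib_left mult.left_commute)
    finally have "(\<Sum>j\<in>I. c j * form (\<tau> j) (\<tau> i)) = d i - g i * (d n - s)"
      by (simp add: d'_def algebra_simps)
    moreover have "cn * form (\<tau> n) (\<tau> i) = g i * (d n - s)"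
      by (simp add: cn_def g_def form_sym[of "\<tau> n" "\<tau> i"])
    ultimately show ?thesis by (simp only: sum)
  qed
  then show ?case using c(1) \<open>0 \<le> cn\<close> by (intro exI[of _ ?c]) auto
qed

end

text \<open>Since \<open>h0\<close> separates the roots, its eigenspaces are the root spaces, and a root is encoded by its
  value on \<open>h0\<close>.\<close>

locale separated_roots = maximal_imaginary_abelian scale bracket Basis conj A
  for scale :: "complex \<Rightarrow> 'a::ab_group_add \<Rightarrow> 'a" and bracket and Basis and conj and A +
  fixes h0 :: 'a
  assumes h0_A: "h0 \<in> A"
    and separating: "a \<in> A \<Longrightarrow> \<exists>d. \<forall>v\<in>eigenspace (bracket h0) c. bracket a v = scale d v"

lemma (in maximal_imaginary_abelian) exists_separated_roots:
  obtains h0 where "separated_roots scale bracket Basis conj A h0"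
proof -
  obtain f where f: "f \<in> bracket ` A"
    "\<And>g c. g \<in> bracket ` A \<Longrightarrow> \<exists>d. \<forall>v\<in>eigenspace f c. g v = scale d v"
  proof (rule exists_separating_operator[of "bracket ` A"])
    show "bracket ` A \<noteq> {}" using A_zero by blast
    show "f (g v) = g (f v)" if "f \<in> bracket ` A" "g \<in> bracket ` A" for f g v
    proof -
      from that obtain x y where xy: "x \<in> A" "y \<in> A" "f = bracket x" "g = bracket y" by blast
      then show ?thesis using bracket_bracket_left[of x y v] commute_A by simp
    qed
    show "(\<lambda>v. f v + scale (of_nat n) (g v)) \<in> bracket ` A"
      if fg: "f \<in> bracket ` A" "g \<in> bracket ` A" for f g n
    proof -
      from fg obtain x y where xy: "x \<in> A" "y \<in> A" "f = bracket x" "g = bracket y" by blast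
      then have "(\<lambda>v. f v + scale (of_nat n) (g v)) = bracket (x + scale (of_real (of_nat n)) y)"
        by (simp add: bracket_add_left bracket_scale_left fun_eq_iff)
      then show ?thesis using xy A_add A_scale by blast
    qed
  qed (use linear_bracket diagonalizable_bracket_imaginary conj_A in auto)
  then obtain h0 where "h0 \<in> A" "f = bracket h0" by blast
  then have "separated_roots scale bracket Basis conj A h0"
    using f(2) by unfold_locales auto
  then show ?thesis by (rule that)
qed

context separated_roots
begin

interpretation endo: vector_space_pair scale scale ..

definition root_space :: "real \<Rightarrow> 'a set" where
  "root_space r = eigenspace (bracket h0) (of_real r)"

definition pos_roots :: "real set" where
  "pos_roots = {r. 0 < r \<and> root_space r \<noteq> {0}}"

definition root_vector :: "real \<Rightarrow> 'a" where
  "root_vector r = (SOME v. v \<in> root_space r \<and> herm v v = 1)"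

text \<open>For a unit root vector this represents the root under the Killing form; it is not the
  customary coroot, which carries the extra factor \<open>2 / (t, t)\<close>.\<close>

definition coroot :: "real \<Rightarrow> 'a" where
  "coroot r = bracket (root_vector r) (- conj (root_vector r))"

text \<open>Decomposition is tested on the representing vectors: \<open>r\<close> is only the value
  of a root at \<open>h0\<close>, and a numerical equality \<open>r = s + t\<close> does not say
  that the roots add up.\<close>

definition simple_roots :: "real set" where
  "simple_roots = {r\<in>pos_roots. \<forall>s\<in>pos_roots. \<forall>t\<in>pos_roots. coroot r \<noteq> coroot s + coroot t}"

lemma subspace_root_space: "subspace (root_space r)"
  unfolding root_space_def by (rule subspace_eigenspace[OF linear_bracket])

lemma root_space_iff: "v \<in> root_space r \<longleftrightarrow> bracket h0 v = scale (of_real r) v"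
  by (simp add: root_space_def eigenspace_def)

lemma conj_root_space: "v \<in> root_space r \<Longrightarrow> conj v \<in> root_space (- r)"
  using conj_bracket[of h0 v] by (simp add: root_space_iff conj_A[OF h0_A] conj_scale bracket_minus_left)

lemma bracket_root_space: "u \<in> root_space r \<Longrightarrow> v \<in> root_space s \<Longrightarrow> bracket u v \<in> root_space (r + s)"
  using bracket_bracket_left[of h0 u v]
  by (simp add: root_space_iff bracket_scale_left bracket_scale_right scale_left_distrib algebra_simps)

text \<open>An \<open>a\<close> in \<open>A\<close> acts on the zero eigenspace of
  \<open>bracket h0\<close> by one scalar, which vanishes unless \<open>a = 0\<close> because
  \<open>a\<close> lies there and kills itself.\<close>

lemma root_space_0: "root_space 0 = torus"
proof
  show "torus \<subseteq> root_space 0"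
    using h0_A bracket_swap[of h0] by (auto simp: torus_def root_space_iff)
  show "root_space 0 \<subseteq> torus"
  proof
    fix x assume x: "x \<in> root_space 0"
    have "bracket a x = 0" if a: "a \<in> A" for a
    proof -
      obtain d where d: "\<forall>v\<in>eigenspace (bracket h0) 0. bracket a v = scale d v"
        using separating[OF a] by blast
      have "a \<in> eigenspace (bracket h0) 0" using commute_A[OF h0_A a] by (simp add: eigenspace_def)
      then have "d = 0 \<or> a = 0" using d bracket_self[of a] by auto
      then show ?thesis using d x by (auto simp: root_space_def)
    qed
    then show "x \<in> torus" using bracket_swap[of x] by (simp add: torus_def)
  qed
qed

lemma finite_pos_roots: "finite pos_roots"
proof -
  have "complex_of_real ` pos_roots \<subseteq> spectrum (bracket h0)"
    using subspace_0[OF subspace_root_space] by (auto simp: pos_roots_def spectrum_def root_space_def)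
  then have "finite (complex_of_real ` pos_roots)"
    using finite_spectrum[OF linear_bracket] finite_subset by blast
  then show ?thesis by (rule finite_imageD) (auto simp: inj_on_def)
qed

lemma pos_rootI: "v \<in> root_space r \<Longrightarrow> v \<noteq> 0 \<Longrightarrow> 0 < r \<Longrightarrow> r \<in> pos_roots"
  by (auto simp: pos_roots_def)

lemma root_vector:
  assumes "r \<in> pos_roots"
  shows "root_vector r \<in> root_space r" "herm (root_vector r) (root_vector r) = 1" "root_vector r \<noteq> 0"
proof -
  obtain u where u: "u \<in> root_space r" "u \<noteq> 0"
    using assms subspace_0[OF subspace_root_space, of r] by (auto simp: pos_roots_def)
  let ?n = "Re (herm u u)"
  have n: "0 < ?n" by (rule herm_self_pos[OF u(2)])
  let ?v = "scale (of_real (1 / sqrt ?n)) u"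
  have "herm ?v ?v = of_real (1 / sqrt ?n * (1 / sqrt ?n) * ?n)"
    by (subst (2) herm_self) (simp add: herm_scale_left herm_scale_right herm_self[symmetric])
  also have "1 / sqrt ?n * (1 / sqrt ?n) * ?n = 1" using n by (simp add: field_simps)
  finally have "?v \<in> root_space r \<and> herm ?v ?v = 1"
    using u(1) subspace_scale[OF subspace_root_space] by simp
  then have "root_vector r \<in> root_space r \<and> herm (root_vector r) (root_vector r) = 1"
    unfolding root_vector_def by (rule someI)
  then show "root_vector r \<in> root_space r" "herm (root_vector r) (root_vector r) = 1" by auto
  then show "root_vector r \<noteq> 0" by auto
qed

lemma coroot_A:
  assumes r: "r \<in> pos_roots"
  shows "coroot r \<in> A"
proof (rule maximal_A)
  let ?v = "root_vector r"
  show "conj (coroot r) = - coroot r"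
    using bracket_swap[of "conj ?v" ?v] by (simp add: coroot_def conj_bracket conj_minus bracket_minus_right)
  have "coroot r \<in> root_space (r + - r)"
    unfolding coroot_def
    by (intro bracket_root_space root_vector r subspace_neg[OF subspace_root_space] conj_root_space)
  then have "coroot r \<in> torus" by (simp add: root_space_0)
  then show "bracket (coroot r) b = 0" if "b \<in> A" for b using that by (simp add: torus_def)
qed

text \<open>Separation provides one scalar \<open>d\<close> for the whole root space. Invariance
  identifies it: the Killing product of \<open>a\<close> with \<open>[v, - conj v]\<close> is that
  of \<open>[a, v]\<close> with \<open>- conj v\<close>, which is \<open>d\<close> times the square
  norm 1 of \<open>v\<close>.\<close>

lemma bracket_A_root_space:
  assumes r: "r \<in> pos_roots" and a: "a \<in> A" and u: "u \<in> root_space r"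
  shows "bracket a u = scale (of_real (form a (coroot r))) u"
proof -
  let ?v = "root_vector r"
  obtain d where d: "\<And>v. v \<in> root_space r \<Longrightarrow> bracket a v = scale d v"
    using separating[OF a] unfolding root_space_def by blast
  have "killing_form a (coroot r) = killing_form (bracket a ?v) (- conj ?v)"
    by (simp add: coroot_def killing_form_invariant)
  also have "\<dots> = d"
    using root_vector[OF r] d[of ?v] killing_form_scale_right[of ?v "-1"]
    by (simp add: killing_form_scale_left herm_def)
  finally show ?thesis using d[OF u] killing_form_A[OF a coroot_A[OF r]] by simp
qed

lemma form_h0_coroot:
  assumes r: "r \<in> pos_roots"
  shows "form h0 (coroot r) = r"
  using bracket_A_root_space[OF r h0_A root_vector(1)[OF r]] root_vector(1,3)[OF r]
  by (simp add: root_space_iff)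

text \<open>A nonzero bracket would be a root vector of value \<open>r - s > 0\<close>, and its root
  would be the difference of the two, writing the simple root \<open>r\<close> as a sum of two
  positive ones.\<close>

lemma simple_difference_less:
  assumes r: "r \<in> simple_roots" and s: "s \<in> simple_roots" and "s < r"
  shows "bracket (root_vector r) (conj (root_vector s)) = 0"
proof (rule ccontr)
  assume neq: "bracket (root_vector r) (conj (root_vector s)) \<noteq> 0"
  let ?w = "bracket (root_vector r) (conj (root_vector s))"
  have rs: "r \<in> pos_roots" "s \<in> pos_roots" using r s by (auto simp: simple_roots_def)
  have w: "?w \<in> root_space (r - s)"
    using bracket_root_space[OF root_vector(1)[OF rs(1)] conj_root_space[OF root_vector(1)[OF rs(2)]]]
    by simp
  then have t: "r - s \<in> pos_roots" using neq \<open>s < r\<close> by (intro pos_rootI) auto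
  have "coroot r = coroot s + coroot (r - s)"
  proof (rule A_eqI)
    fix a assume a: "a \<in> A"
    have "bracket a (conj (root_vector s)) = scale (- of_real (form a (coroot s))) (conj (root_vector s))"
      using arg_cong[OF bracket_A_root_space[OF rs(2) a root_vector(1)[OF rs(2)]], of conj] conj_A[OF a]
      by (simp add: conj_bracket conj_scale bracket_minus_left neg_eq_iff_add_eq_0 eq_neg_iff_add_eq_0)
    then have "bracket a ?w = scale (of_real (form a (coroot r) - form a (coroot s))) ?w"
      using bracket_bracket_left[of a "root_vector r" "conj (root_vector s)"]
        bracket_A_root_space[OF rs(1) a root_vector(1)[OF rs(1)]]
      by (simp add: bracket_scale_left bracket_scale_right bracket_minus_right scale_left_diff_distrib
          algebra_simps)
    then have "of_real (form a (coroot r) - form a (coroot s)) = complex_of_real (form a (coroot (r - s)))"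
      using bracket_A_root_space[OF t a w] neq by simp
    then show "form a (coroot r) = form a (coroot s + coroot (r - s))"
      unfolding of_real_eq_iff by (simp add: form_add_right)
  qed (use rs t coroot_A A_add in auto)
  then show False using r rs t by (auto simp: simple_roots_def)
qed

lemma simple_difference:
  assumes r: "r \<in> simple_roots" and s: "s \<in> simple_roots" and "r \<noteq> s"
  shows "bracket (root_vector r) (conj (root_vector s)) = 0"
proof (cases "s < r")
  case True
  then show ?thesis using simple_difference_less r s by blast
next
  case False
  then have "bracket (root_vector s) (conj (root_vector r)) = 0"
    using simple_difference_less r s \<open>r \<noteq> s\<close> by simp
  then have "conj (bracket (root_vector s) (conj (root_vector r))) = 0" by simp
  then show ?thesis
    using bracket_swap[of "root_vector r" "conj (root_vector s)"] by (simp add: conj_bracket)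
qed

text \<open>For the unit vectors \<open>u\<close>, \<open>v\<close> of \<open>r\<close>,
  \<open>s\<close>, the square norm of \<open>[u, v]\<close> equals
  \<open>- form (coroot r) (coroot s)\<close>: move \<open>u\<close> to the other side and use
  Jacobi, where \<open>[conj u, v] = 0\<close>.\<close>

lemma simple_coroots_obtuse:
  assumes r: "r \<in> simple_roots" and s: "s \<in> simple_roots" and "r \<noteq> s"
  shows "form (coroot r) (coroot s) \<le> 0"
proof -
  let ?u = "root_vector r" and ?v = "root_vector s"
  have rs: "r \<in> pos_roots" "s \<in> pos_roots" using r s by (auto simp: simple_roots_def)
  have "bracket (- conj ?u) ?v = 0"
    using simple_difference[OF s r] \<open>r \<noteq> s\<close> bracket_swap[of ?v "conj ?u"] by (simp add: bracket_minus_left)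
  then have "bracket (- conj ?u) (bracket ?u ?v) = - bracket (coroot r) ?v"
    using bracket_bracket_left[of ?u "- conj ?u" ?v] by (simp add: coroot_def)
  also have "\<dots> = scale (- of_real (form (coroot r) (coroot s))) ?v"
    using bracket_A_root_space[OF rs(2) coroot_A[OF rs(1)] root_vector(1)[OF rs(2)]] by simp
  finally have "herm (bracket ?u ?v) (bracket ?u ?v) = - of_real (form (coroot r) (coroot s))"
    using root_vector(2)[OF rs(2)] herm_scale_right[of ?v "- of_real (form (coroot r) (coroot s))" ?v]
    by (simp add: herm_bracket_left)
  then show ?thesis using herm_self_nonneg[of "bracket ?u ?v"] by simp
qed

text \<open>A positive root that is not simple is a sum of two with smaller values at
  \<open>h0\<close>. Values are real numbers, so the induction counts the finitely many positive
  roots below.\<close>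

lemma even_on_pos_roots:
  assumes h: "h \<in> A" "\<And>r. r \<in> simple_roots \<Longrightarrow> form h (coroot r) = 2" and r: "r \<in> pos_roots"
  shows "\<exists>n::int. 0 < n \<and> form h (coroot r) = of_int (2 * n)"
  using r
proof (induction r rule: measure_induct_rule[of "\<lambda>r. card {s\<in>pos_roots. s < r}"])
  case (less r)
  show ?case
  proof (cases "r \<in> simple_roots")
    case True
    then show ?thesis using h(2) by (intro exI[of _ 1]) simp
  next
    case False
    then obtain s t where st: "s \<in> pos_roots" "t \<in> pos_roots" "coroot r = coroot s + coroot t"
      using less.prems by (auto simp: simple_roots_def)
    have "r = s + t"
      using st form_h0_coroot[OF less.prems] by (simp add: form_add_right form_h0_coroot)
    moreover have "0 < s" "0 < t" using st by (auto simp: pos_roots_def)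
    ultimately have "s < r" "t < r" by auto
    have card: "card {x \<in> pos_roots. x < q} < card {x \<in> pos_roots. x < r}" if "q \<in> pos_roots" "q < r" for q
      using that finite_pos_roots by (intro psubset_card_mono) auto
    obtain m n :: int where "0 < m" "form h (coroot s) = of_int (2 * m)"
      "0 < n" "form h (coroot t) = of_int (2 * n)"
      using less.IH[OF card st(1)] less.IH[OF card st(2)] st \<open>s < r\<close> \<open>t < r\<close> by blast
    then show ?thesis by (intro exI[of _ "m + n"]) (simp add: st(3) form_add_right)
  qed
qed

text \<open>Without positive roots there are no negative ones either, by \<open>conj\<close>, and
  everything would lie in the abelian torus. The smallest positive root cannot be a sum of
  two.\<close>

lemma exists_simple_root:
  assumes "bracket x y \<noteq> 0"
  shows "simple_roots \<noteq> {}"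
proof -
  have "pos_roots \<noteq> {}"
  proof
    assume none: "pos_roots = {}"
    have "v \<in> torus" for v
    proof -
      obtain \<Lambda> u where u: "\<And>c. c \<in> \<Lambda> \<Longrightarrow> u c \<in> eigenspace (bracket h0) c" "v = (\<Sum>c\<in>\<Lambda>. u c)"
        using diagonalizable_decompose[OF linear_bracket subspace_UNIV _
            diagonalizable_bracket_imaginary[OF conj_A[OF h0_A]], of v] by blast
      have "u c \<in> root_space 0" if c: "c \<in> \<Lambda>" for c
      proof (cases "u c = 0")
        case True
        then show ?thesis using subspace_0[OF subspace_root_space] by simp
      next
        case False
        have "cnj c = c"
          using self_adjoint_eigenvalue_real[OF herm_bracket_imaginary[OF conj_A[OF h0_A]] u(1)[OF c] False] .
        then have cr: "c = of_real (Re c)" by (simp add: complex_eq_iff)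
        then have uc: "u c \<in> root_space (Re c)" using u(1)[OF c] by (simp add: root_space_def)
        have "conj (u c) \<noteq> 0" using False by (metis conj_conj conj_0)
        then have "Re c = 0"
          using pos_rootI[OF uc False] pos_rootI[OF conj_root_space[OF uc]] none by force
        then show ?thesis using uc by simp
      qed
      then show ?thesis
        unfolding u(2) root_space_0[symmetric] by (rule subspace_sum[OF subspace_root_space])
    qed
    then show False using cartan_torus assms by (auto simp: cartan_subalgebra_def)
  qed
  define m where "m = Min pos_roots"
  have m: "m \<in> pos_roots" "\<And>s. s \<in> pos_roots \<Longrightarrow> m \<le> s"
    using finite_pos_roots \<open>pos_roots \<noteq> {}\<close> by (auto simp: m_def)
  have "m \<in> simple_roots"
    unfolding simple_roots_def
  proof (intro CollectI conjI ballI notI m(1))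
    fix s t assume st: "s \<in> pos_roots" "t \<in> pos_roots" "coroot m = coroot s + coroot t"
    then have "m = s + t"
      using form_h0_coroot[OF m(1)] by (simp add: form_add_right form_h0_coroot)
    moreover have "0 < t" using st by (auto simp: pos_roots_def)
    ultimately show False using m(2)[OF st(1)] by simp
  qed
  then show ?thesis by blast
qed

lemma exists_principal_triple:
  assumes "bracket x y \<noteq> 0"
  obtains e h where "conj h = - h" "bracket h e = scale 2 e" "bracket e (- conj e) = h"
    "principal_nilpotent e" "e \<noteq> 0"
proof -
  have simple_pos: "r \<in> pos_roots" if "r \<in> simple_roots" for r
    using that by (simp add: simple_roots_def)
  have fin: "finite simple_roots"
    by (rule finite_subset[OF _ finite_pos_roots]) (auto simp: simple_roots_def)
  have "\<exists>c. \<forall>r\<in>simple_roots. 0 \<le> c r \<and> (\<Sum>s\<in>simple_roots. c s * form (coroot s) (coroot r)) = 2"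
  proof (rule obtuse_system_solution[OF fin h0_A])
    show "0 < form h0 (coroot r)" if "r \<in> simple_roots" for r
      using simple_pos[OF that] form_h0_coroot by (simp add: pos_roots_def)
  qed (use simple_pos coroot_A simple_coroots_obtuse in auto)
  then obtain c where c: "\<And>r. r \<in> simple_roots \<Longrightarrow> 0 \<le> c r"
    "\<And>r. r \<in> simple_roots \<Longrightarrow> (\<Sum>s\<in>simple_roots. c s * form (coroot s) (coroot r)) = 2" by blast
  define h where "h = (\<Sum>r\<in>simple_roots. scale (of_real (c r)) (coroot r))"
  \<comment> \<open>In \<open>[e, - conj e]\<close> the mixed terms vanish for simple roots, and the
    diagonal ones carry the squares \<open>c r\<close>; the square roots thus reproduce
    \<open>h\<close>.\<close>
  define e where "e = (\<Sum>r\<in>simple_roots. scale (of_real (sqrt (c r))) (root_vector r))"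
  have hA: "h \<in> A" unfolding h_def by (intro A_sum A_scale coroot_A simple_pos)
  have conj_h: "conj h = - h" by (rule conj_A[OF hA])
  have h2: "form h (coroot r) = 2" if "r \<in> simple_roots" for r
    using c(2)[OF that] by (simp add: h_def form_sum_left form_scale_left)
  have he: "bracket h e = scale 2 e"
    unfolding e_def bracket_sum_right scale_sum_right
  proof (rule sum.cong)
    fix r assume r: "r \<in> simple_roots"
    have "bracket h (root_vector r) = scale 2 (root_vector r)"
      using bracket_A_root_space[OF simple_pos[OF r] hA root_vector(1)[OF simple_pos[OF r]]] h2[OF r] by simp
    then show "bracket h (scale (of_real (sqrt (c r))) (root_vector r)) =
        scale 2 (scale (of_real (sqrt (c r))) (root_vector r))"
      by (simp add: bracket_scale_right mult.commute)
  qed simp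
  have e_left: "bracket e w = (\<Sum>r\<in>simple_roots. scale (of_real (sqrt (c r))) (bracket (root_vector r) w))" for w
    by (simp add: e_def bracket_sum_left bracket_scale_left)
  have e_right: "bracket w (- conj e) =
      (\<Sum>s\<in>simple_roots. scale (of_real (sqrt (c s))) (bracket w (- conj (root_vector s))))" for w
    by (simp add: e_def conj_sum conj_scale bracket_sum_right bracket_scale_right bracket_minus_right
        sum_negf)
  have "bracket e (- conj e) = (\<Sum>r\<in>simple_roots. \<Sum>s\<in>simple_roots.
      scale (of_real (sqrt (c r)) * of_real (sqrt (c s))) (bracket (root_vector r) (- conj (root_vector s))))"
    by (subst e_left, simp only: e_right scale_sum_right scale_scale)
  also have "\<dots> = h"
    unfolding h_def
  proof (rule sum.cong)
    fix r assume r: "r \<in> simple_roots"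
    have "(\<Sum>s\<in>simple_roots.
        scale (of_real (sqrt (c r)) * of_real (sqrt (c s))) (bracket (root_vector r) (- conj (root_vector s)))) =
        (\<Sum>s\<in>simple_roots. if s = r then scale (of_real (c r)) (coroot r) else 0)"
    proof (rule sum.cong)
      fix s assume s: "s \<in> simple_roots"
      have "complex_of_real (sqrt (c r)) * of_real (sqrt (c r)) = of_real (c r)"
        using c(1)[OF r] by (simp flip: of_real_mult)
      then show "scale (of_real (sqrt (c r)) * of_real (sqrt (c s))) (bracket (root_vector r) (- conj (root_vector s)))
          = (if s = r then scale (of_real (c r)) (coroot r) else 0)"
        using simple_difference[OF r s] by (auto simp: coroot_def bracket_minus_right)
    qed simp
    then show "(\<Sum>s\<in>simple_roots.
        scale (of_real (sqrt (c r)) * of_real (sqrt (c s))) (bracket (root_vector r) (- conj (root_vector s)))) =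
        scale (of_real (c r)) (coroot r)"
      using r fin by simp
  qed simp
  finally have ef: "bracket e (- conj e) = h" .
  have even_pos: "\<exists>k::int. 0 < k \<and> bracket h u = scale (of_int (2 * k)) u"
    if r: "r \<in> pos_roots" and u: "u \<in> root_space r" for u r
  proof -
    obtain n :: int where n: "0 < n" "form h (coroot r) = of_int (2 * n)"
      using even_on_pos_roots[OF hA h2 r] by blast
    then show ?thesis using bracket_A_root_space[OF r hA u] by (intro exI[of _ n]) simp
  qed
  \<comment> \<open>The clause on \<open>k = 0\<close> records that no root vanishes on
    \<open>h\<close>; it will place the zero eigenspace of \<open>h\<close> inside the
    torus.\<close>
  have even_roots: "\<exists>k::int. bracket h u = scale (of_int (2 * k)) u \<and> (k = 0 \<longrightarrow> u \<in> torus)"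
    if u: "u \<in> eigenspace (bracket h0) d" for u d
  proof (cases "u = 0")
    case True
    then show ?thesis using A_zero A_subset_torus by auto
  next
    case False
    have "cnj d = d"
      using self_adjoint_eigenvalue_real[OF herm_bracket_imaginary[OF conj_A[OF h0_A]] u False] .
    then have "d = of_real (Re d)" by (simp add: complex_eq_iff)
    then have ur: "u \<in> root_space (Re d)" using u by (simp add: root_space_def)
    consider "0 < Re d" | "Re d = 0" | "Re d < 0" by linarith
    then show ?thesis
    proof cases
      case 1
      then obtain k :: int where "0 < k" "bracket h u = scale (of_int (2 * k)) u"
        using even_pos[OF pos_rootI[OF ur False] ur] by blast
      then show ?thesis by (intro exI[of _ k]) simp
    next
      case 2
      then have "u \<in> torus" using ur root_space_0 by simp
      then show ?thesis using hA bracket_swap[of h u] by (intro exI[of _ 0]) (simp add: torus_def)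
    next
      case 3
      have "conj u \<noteq> 0" using False by (metis conj_conj conj_0)
      then obtain k :: int where k: "0 < k" "bracket h (conj u) = scale (of_int (2 * k)) (conj u)"
        using even_pos[OF pos_rootI[OF conj_root_space[OF ur]] conj_root_space[OF ur]] 3 by auto
      have "- bracket h u = scale (of_int (2 * k)) u"
        using arg_cong[OF k(2), of conj] by (simp add: conj_bracket conj_h conj_scale bracket_minus_left)
      then have "bracket h u = scale (of_int (2 * - k)) u"
        by (metis minus_minus mult_minus_right of_int_minus scale_minus_left)
      then show ?thesis using k(1) by (intro exI[of _ "- k"]) simp
    qed
  qed
  have decompose: "\<exists>\<Lambda> u. finite \<Lambda> \<and> (\<forall>d\<in>\<Lambda>. u d \<in> eigenspace (bracket h0) d) \<and> v = (\<Sum>d\<in>\<Lambda>. u d)" for v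
    using diagonalizable_decompose[OF linear_bracket subspace_UNIV _
        diagonalizable_bracket_imaginary[OF conj_A[OF h0_A]], of v] by (metis UNIV_I)
  have even: "span (\<Union>k. eigenspace (bracket h) (of_int (2 * k))) = UNIV"
  proof -
    have "v \<in> span (\<Union>k. eigenspace (bracket h) (of_int (2 * k)))" for v
    proof -
      obtain \<Lambda> u where u: "\<forall>d\<in>\<Lambda>. u d \<in> eigenspace (bracket h0) d" "v = (\<Sum>d\<in>\<Lambda>. u d)"
        using decompose[of v] by blast
      have "u d \<in> (\<Union>k. eigenspace (bracket h) (of_int (2 * k)))" if "d \<in> \<Lambda>" for d
        using even_roots[of "u d" d] u(1) that unfolding eigenspace_def by blast
      then show ?thesis unfolding u(2) by (intro span_sum span_base)
    qed
    then show ?thesis by blast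
  qed
  have "eigenspace (bracket h) 0 \<subseteq> torus"
  proof
    fix v assume v: "v \<in> eigenspace (bracket h) 0"
    obtain \<Lambda> u where u: "finite \<Lambda>" "\<And>d. d \<in> \<Lambda> \<Longrightarrow> u d \<in> eigenspace (bracket h0) d" "v = (\<Sum>d\<in>\<Lambda>. u d)"
      using decompose[of v] by blast
    have inv: "bracket h0 w \<in> eigenspace (bracket h) 0" if "w \<in> eigenspace (bracket h) 0" for w
      using that bracket_bracket_left[of h h0 w] commute_A[OF hA h0_A] by (simp add: eigenspace_def)
    have "u d \<in> torus" if d: "d \<in> \<Lambda>" for d
    proof -
      have "u d \<in> eigenspace (bracket h) 0"
        using eigen_component_mem[OF linear_bracket subspace_eigenspace[OF linear_bracket] inv u(1,2) _ d]
          v u(3) by simp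
      then have "bracket h (u d) = 0" by (simp add: eigenspace_def)
      moreover obtain k :: int where "bracket h (u d) = scale (of_int (2 * k)) (u d)" "k = 0 \<longrightarrow> u d \<in> torus"
        using even_roots[OF u(2)[OF d]] by blast
      ultimately show ?thesis using A_zero A_subset_torus by (cases "k = 0") auto
    qed
    then show "v \<in> torus"
      unfolding u(3) using cartan_torus by (intro subspace_sum) (auto simp: cartan_subalgebra_def)
  qed
  then have "dim (eigenspace (bracket h) 0) \<le> dim torus" by (rule dim_subset)
  moreover note sl2 = sl2_even_weights[OF conj_h refl he ef even]
  \<comment> \<open>This closes the chain \<open>dim torus = lie_rank <= dim (centralizer e) <= dim
    (eigenspace (bracket h) 0) <= dim torus\<close>. The chosen Cartan subalgebra is a genuine one
    because \<open>torus\<close> witnesses existence.\<close>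
  moreover have rank: "cartan_subalgebra (SOME H. cartan_subalgebra H)"
    by (rule someI[of cartan_subalgebra, OF cartan_torus])
  have "dim torus = lie_rank" "lie_rank \<le> dim (centralizer e)"
    unfolding lie_rank_def
    by (rule dim_cartan_unique[OF killing_form_nondegenerate cartan_torus rank]
        dim_cartan_le_dim_centralizer[OF killing_form_nondegenerate rank]; assumption)+
  ultimately have "principal_nilpotent e" by (simp add: principal_nilpotent_def)
  moreover have "e \<noteq> 0"
  proof
    assume "e = 0"
    then have "h = 0" using ef by simp
    moreover obtain r where "r \<in> simple_roots" using exists_simple_root[OF assms] by blast
    ultimately show False using h2[of r] form_diff_left[of 0 0 "coroot r"] by simp
  qed
  ultimately show ?thesis using that conj_h he ef by blast
qed

end

theorem (in compact_conjugation) exists_principal_triple: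
  assumes "bracket x y \<noteq> 0"
  obtains e h where "conj h = - h" "bracket h e = scale 2 e" "bracket e (- conj e) = h"
    "principal_nilpotent e" "e \<noteq> 0"
proof -
  obtain A where "maximal_imaginary_abelian scale bracket Basis conj A"
    by (rule exists_maximal_imaginary_abelian)
  then obtain h0 where "separated_roots scale bracket Basis conj A h0"
    by (rule maximal_imaginary_abelian.exists_separated_roots)
  from separated_roots.exists_principal_triple[OF this assms] show ?thesis using that by blast
qed

section \<open>The real three-dimensional subalgebra\<close>

context real_lie_algebra
begin

text \<open>Allows minimality of the real span to be used for the real points of a complex
  span.\<close>

lemma real_subspace_cspan: "subspace {x. (x, 0) \<in> complexification.span P}"
  unfolding subspace_def
proof (intro conjI ballI allI CollectI)
  show "(0, 0) \<in> complexification.span P"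
    using complexification.span_zero by (simp add: zero_prod_def)
  fix x y r assume "x \<in> {x. (x, 0) \<in> complexification.span P}" "y \<in> {x. (x, 0) \<in> complexification.span P}"
  then show "(x + y, 0) \<in> complexification.span P" "(scale r x, 0) \<in> complexification.span P"
    using complexification.span_add[of "(x, 0)" P "(y, 0)"]
      complexification.span_scale[of "(x, 0)" P "of_real r"]
    by (simp_all add: complex_scale_def)
qed

lemma pair_mem_cspan:
  assumes "(x, 0) \<in> complexification.span P" "(y, 0) \<in> complexification.span P"
  shows "(x, y) \<in> complexification.span P"
  using complexification.span_add[OF assms(1) complexification.span_scale[OF assms(2), of \<i>]]
  by (simp add: complex_scale_def)

lemma csubspace_Times: "subspace S \<Longrightarrow> complexification.subspace (S \<times> S)"
  unfolding complexification.subspace_def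
  by (auto simp: complex_scale_def mem_Times_iff intro: subspace_0 subspace_add subspace_diff subspace_scale)

text \<open>Serves to compute complex traces, and so the complex Killing form, in a real
  basis.\<close>

lemma complexification_basis:
  assumes B: "independent B" "span B = UNIV" and fin: "finite B"
  shows "complexification.independent ((\<lambda>b. (b, 0)) ` B)"
    and "complexification.span ((\<lambda>b. (b, 0)) ` B) = UNIV"
    and "\<And>b. b \<in> B \<Longrightarrow> complexification.representation ((\<lambda>b. (b, 0)) ` B) p (b, 0) =
      Complex (representation B (fst p) b) (representation B (snd p) b)"
proof -
  let ?C = "(\<lambda>b. (b, 0 :: 'a)) ` B"
  have inj: "inj_on (\<lambda>b. (b, 0 :: 'a)) B" by (auto simp: inj_on_def)
  have sum_pair: "(\<Sum>i\<in>I. (f i, g i)) = (\<Sum>i\<in>I. f i, \<Sum>i\<in>I. g i)"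
    for I :: "'a set" and f g :: "'a \<Rightarrow> 'a"
    by (induction I rule: infinite_finite_induct) (auto simp: zero_prod_def)
  have csum: "(\<Sum>q\<in>?C. complex_scale (f q) q) =
      (\<Sum>b\<in>B. scale (Re (f (b, 0))) b, \<Sum>b\<in>B. scale (Im (f (b, 0))) b)" for f
    by (simp add: sum.reindex[OF inj] complex_scale_def sum_pair)
  show ind: "complexification.independent ?C"
  proof (rule complexification.independent_if_scalars_zero)
    show "finite ?C" using fin by simp
    fix f q assume f: "(\<Sum>q\<in>?C. complex_scale (f q) q) = 0" and q: "q \<in> ?C"
    then obtain b where b: "q = (b, 0)" "b \<in> B" by blast
    from f have "(\<Sum>b\<in>B. scale (Re (f (b, 0))) b) = 0" "(\<Sum>b\<in>B. scale (Im (f (b, 0))) b) = 0"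
      by (simp_all add: csum zero_prod_def)
    then have "Re (f (b, 0)) = 0" "Im (f (b, 0)) = 0"
      using independentD[OF B(1) fin order.refl, of "\<lambda>b. Re (f (b, 0))" b]
        independentD[OF B(1) fin order.refl, of "\<lambda>b. Im (f (b, 0))" b] b(2) by auto
    then show "f q = 0" using b by (simp add: complex_eq_iff)
  qed
  have "B \<subseteq> {x. (x, 0) \<in> complexification.span ?C}"
    by (auto intro: complexification.span_base)
  then have "span B \<subseteq> {x. (x, 0) \<in> complexification.span ?C}"
    by (rule span_minimal) (rule real_subspace_cspan)
  then have "(x, 0) \<in> complexification.span ?C" for x using B(2) by auto
  then have "p \<in> complexification.span ?C" for p
    using pair_mem_cspan[of "fst p" ?C "snd p"] by simp
  then show sp: "complexification.span ?C = UNIV" by blast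
  show "complexification.representation ?C p (b, 0) =
      Complex (representation B (fst p) b) (representation B (snd p) b)" if b: "b \<in> B" for b
  proof -
    let ?r = "complexification.representation ?C p"
    have eq: "(\<Sum>q\<in>?C. complex_scale (?r q) q) = p"
      using fin by (intro complexification.sum_representation_eq ind) (auto simp: sp)
    have p1: "(\<Sum>b\<in>B. scale (Re (?r (b, 0))) b) = fst p"
      using arg_cong[OF eq[unfolded csum], of fst] unfolding fst_conv .
    have p2: "(\<Sum>b\<in>B. scale (Im (?r (b, 0))) b) = snd p"
      using arg_cong[OF eq[unfolded csum], of snd] unfolding snd_conv .
    have rep: "representation B (\<Sum>b\<in>B. scale (g b) b) b = g b" for g
    proof -
      have "representation B (\<Sum>b\<in>B. scale (g b) b) b = (\<Sum>x\<in>B. g x * representation B x b)"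
        using B by (simp add: representation_sum representation_scale)
      also have "\<dots> = (\<Sum>x\<in>B. if x = b then g x else 0)"
        using B(1) by (intro sum.cong) (auto simp: representation_basis)
      also have "\<dots> = g b" using fin b by simp
      finally show ?thesis .
    qed
    show ?thesis
      using rep[of "\<lambda>b. Re (?r (b, 0))"] rep[of "\<lambda>b. Im (?r (b, 0))"]
      unfolding p1 p2 by (simp add: complex_eq_iff)
  qed
qed

text \<open>The Killing form of the complexification is the bilinear extension of the real one.
  Hence the product of \<open>x + i y\<close> with its conjugate has real part
  \<open>killing_form x x + killing_form y y\<close>, which is negative for a nonzero
  vector.\<close>

lemma exists_compact_conjugation:
  assumes fd: "finite_dim" and compact: "compact_type"
  obtains B where
    "compact_conjugation complex_scale complex_bracket B (\<lambda>p. (fst p, - snd p))"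
proof -
  define B where "B = extend_basis {}"
  have B: "independent B" "span B = UNIV"
    unfolding B_def by (rule independent_extend_basis[OF independent_empty],
        rule span_extend_basis[OF independent_empty])
  obtain B' where B': "finite B'" "span B' = UNIV" using fd by (auto simp: finite_dim_def)
  have fin: "finite B" using independent_span_bound[OF B'(1) B(1)] B'(2) by simp
  let ?C = "(\<lambda>b. (b, 0 :: 'a)) ` B"
  note C = complexification_basis[OF B fin]
  interpret r: fd_lie_algebra scale bracket B
    by unfold_locales (fact fin B)+
  interpret c: fd_lie_algebra complex_scale complex_bracket ?C
    by unfold_locales (use fin C in auto)
  have K: "killing_form x y = (\<Sum>b\<in>B. representation B (bracket x (bracket y b)) b)" for x y
    by (simp add: killing_form_def operator_trace_def Let_def B_def)
  have cK: "complexification.killing_form p q =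
      Complex (killing_form (fst p) (fst q) - killing_form (snd p) (snd q))
        (killing_form (fst p) (snd q) + killing_form (snd p) (fst q))" for p q
  proof -
    have lin: "Vector_Spaces.linear complex_scale complex_scale (\<lambda>v. complex_bracket p (complex_bracket q v))"
      using Vector_Spaces.linear_compose[OF complexification.linear_bracket[of q]
          complexification.linear_bracket[of p]] by (simp add: o_def)
    have inj: "inj_on (\<lambda>b. (b, 0 :: 'a)) B" by (auto simp: inj_on_def)
    have rep: "complexification.representation ?C (complex_bracket p (complex_bracket q (b, 0))) (b, 0) =
        Complex (representation B (bracket (fst p) (bracket (fst q) b)) b
            - representation B (bracket (snd p) (bracket (snd q) b)) b)
          (representation B (bracket (fst p) (bracket (snd q) b)) b
            + representation B (bracket (snd p) (bracket (fst q) b)) b)" if "b \<in> B" for b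
      unfolding C(3)[OF that] using B
      by (simp add: complex_bracket_def representation_diff representation_add)
    have "complexification.killing_form p q =
        (\<Sum>b\<in>B. complexification.representation ?C (complex_bracket p (complex_bracket q (b, 0))) (b, 0))"
      unfolding complexification.killing_form_def c.operator_trace_basis[OF lin C(1,2)]
      by (simp add: sum.reindex[OF inj])
    then show ?thesis
      by (simp add: rep K complex_eq_iff Re_sum Im_sum sum.distrib sum_subtractf)
  qed
  have Kneg: "killing_form x (- y) = - killing_form x y" "killing_form (- x) y = - killing_form x y" for x y
    using r.killing_form_scale_right[of x "-1" y] r.killing_form_scale_left[of "-1" x y] by auto
  have "compact_conjugation complex_scale complex_bracket ?C (\<lambda>p. (fst p, - snd p))"
  proof
    fix x y :: "'a \<times> 'a" and c :: complex
    show "(fst (x + y), - snd (x + y)) = (fst x, - snd x) + (fst y, - snd y)" by simp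
    show "(fst (complex_scale c x), - snd (complex_scale c x)) = complex_scale (cnj c) (fst x, - snd x)"
      by (simp add: complex_scale_def)
    show "(fst (fst x, - snd x), - snd (fst x, - snd x)) = x" by simp
    show "(fst (complex_bracket x y), - snd (complex_bracket x y)) =
        complex_bracket (fst x, - snd x) (fst y, - snd y)"
      by (simp add: complex_bracket_def bracket_minus_left bracket_minus_right)
    show "complexification.killing_form (fst x, - snd x) (fst y, - snd y) =
        cnj (complexification.killing_form x y)"
      by (simp add: cK Kneg complex_eq_iff)
    have nonpos: "killing_form z z \<le> 0" for z
      using compact Kneg(1)[of 0 0] unfolding compact_type_def by (cases "z = 0") (auto simp: less_imp_le)
    assume "x \<noteq> 0"
    then have "fst x \<noteq> 0 \<or> snd x \<noteq> 0" by (simp add: prod_eq_iff)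
    then have "killing_form (fst x) (fst x) + killing_form (snd x) (snd x) < 0"
      using compact nonpos unfolding compact_type_def by (meson add_neg_nonpos add_nonpos_neg)
    then show "Re (complexification.killing_form x (fst x, - snd x)) < 0"
      by (simp add: cK Kneg)
  qed
  then show ?thesis by (rule that)
qed

lemma span_triple: "x \<in> span {a, b, c} \<longleftrightarrow> (\<exists>r s t. x = scale r a + scale s b + scale t c)"
proof
  assume "x \<in> span {a, b, c}"
  then obtain r s t where "x - scale r a - scale s b - scale t c = 0"
    by (auto simp: span_breakdown_eq)
  then have "x = scale r a + scale s b + scale t c" by (simp add: algebra_simps)
  then show "\<exists>r s t. x = scale r a + scale s b + scale t c" by blast
qed (auto intro!: span_add span_scale intro: span_base)

text \<open>These are the relations of su(2), scaled as they arise from \<open>e = a + i b\<close>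
  and \<open>h = i c\<close>: \<open>[e, - conj e] = h\<close> means \<open>c = 2 [a, b]\<close>,
  and \<open>[h, e] = 2 e\<close> gives the other two.\<close>

lemma su2_triple_span:
  assumes ab: "bracket a b = scale (1/2) c" and bc: "bracket b c = scale 2 a"
    and ca: "bracket c a = scale 2 b" and a0: "a \<noteq> 0"
  shows "simple_subalgebra (span {a, b, c})" "dim (span {a, b, c}) = 3"
proof -
  let ?S = "span {a, b, c}"
  have ba: "bracket b a = scale (-1/2) c" and cb: "bracket c b = scale (-2) a"
    and ac: "bracket a c = scale (-2) b"
    using bracket_swap[of b a] bracket_swap[of c b] bracket_swap[of a c] ab bc ca by simp_all
  note table = ab bc ca ba cb ac bracket_self bracket_add_left bracket_add_right
    bracket_scale_left bracket_scale_right
  have b0: "b \<noteq> 0" using bc a0 by auto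
  have c0: "c \<noteq> 0" using bc a0 by auto
  \<comment> \<open>Each double bracket isolates one coordinate of \<open>v\<close>. So a nonzero
    ideal contains a basis vector, and a vanishing combination has vanishing coefficients:
    simplicity and dimension both follow.\<close>
  have coord: "bracket a (bracket b v) = scale r b" "bracket b (bracket c v) = scale s c"
    "bracket c (bracket a v) = scale (4 * t) a" if "v = scale r a + scale s b + scale t c" for v r s t
    by (simp_all add: that table bracket_diff_right)
  have gen: "a \<in> ?S" "b \<in> ?S" "c \<in> ?S" by (auto intro: span_base)
  have sub: "lie_subalgebra ?S"
    unfolding lie_subalgebra_def
  proof (intro conjI ballI)
    fix x y assume "x \<in> ?S" "y \<in> ?S"
    then obtain r s t r' s' t' where xy: "x = scale r a + scale s b + scale t c"
      "y = scale r' a + scale s' b + scale t' c" by (auto simp: span_triple)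
    show "bracket x y \<in> ?S"
      unfolding xy table by (intro span_add span_scale gen span_zero)
  qed simp
  have ideal: "I = {0} \<or> I = ?S" if I: "lie_ideal_of I ?S" for I
  proof (cases "I = {0}")
    case False
    have subI: "subspace I" and IS: "I \<subseteq> ?S" and br: "\<And>x y. x \<in> ?S \<Longrightarrow> y \<in> I \<Longrightarrow> bracket x y \<in> I"
      using I by (auto simp: lie_ideal_of_def)
    have unscale: "x \<in> I" if "scale r x \<in> I" "r \<noteq> 0" for x and r :: real
      using subspace_scale[OF subI that(1), of "inverse r"] that(2) by simp
    have A: "b \<in> I \<and> c \<in> I" if "a \<in> I"
      using br[OF gen(2) that] br[OF gen(3) that] unscale[of "-1/2" c] unscale[of 2 b] by (simp add: ba ca)
    have Bm: "a \<in> I" if "b \<in> I"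
      using br[OF gen(3) that] unscale[of "-2" a] by (simp add: cb)
    have Cm: "a \<in> I" if "c \<in> I"
      using br[OF gen(2) that] unscale[of 2 a] by (simp add: bc)
    obtain v where v: "v \<in> I" "v \<noteq> 0" using False subspace_0[OF subI] by blast
    obtain r s t where v': "v = scale r a + scale s b + scale t c"
      using subsetD[OF IS v(1)] unfolding span_triple by blast
    have "scale r b \<in> I" "scale s c \<in> I" "scale (4 * t) a \<in> I"
      using br[OF gen(1) br[OF gen(2) v(1)]] br[OF gen(2) br[OF gen(3) v(1)]]
        br[OF gen(3) br[OF gen(1) v(1)]] coord[OF v'] by auto
    moreover have "r \<noteq> 0 \<or> s \<noteq> 0 \<or> 4 * t \<noteq> 0" using v' v(2) by auto
    ultimately have "a \<in> I" using unscale Bm Cm by blast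
    then have "?S \<subseteq> I" using A by (intro span_minimal subI) auto
    then show ?thesis using IS by blast
  qed simp
  have "bracket b c \<noteq> 0" using bc a0 by simp
  then show "simple_subalgebra ?S"
    unfolding simple_subalgebra_def using sub ideal gen by blast
  have zero: "r = 0 \<and> s = 0 \<and> t = 0" if "scale r a + scale s b + scale t c = 0" for r s t
    using coord[of 0 r s t] that a0 b0 c0 by simp
  have dist: "a \<noteq> b" "b \<noteq> c" "a \<noteq> c"
    using zero[of 1 "-1" 0] zero[of 0 1 "-1"] zero[of 1 0 "-1"] by auto
  have "independent {a, b, c}"
  proof (rule independent_if_scalars_zero)
    fix g x assume "(\<Sum>x\<in>{a, b, c}. scale (g x) x) = 0" "x \<in> {a, b, c}"
    then show "g x = 0" using zero[of "g a" "g b" "g c"] dist by (auto simp: add.assoc)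
  qed simp
  then show "dim ?S = 3" using dist by (simp add: dim_eq_card_independent)
qed

theorem exists_principal_three_dim_subalgebra:
  assumes fd: "finite_dim" and compact: "compact_type" and nonabelian: "bracket x y \<noteq> 0"
  shows "\<exists>S. principal_three_dim_subalgebra S"
proof -
  obtain B where B: "compact_conjugation complex_scale complex_bracket B (\<lambda>p. (fst p, - snd p))"
    using exists_compact_conjugation[OF fd compact] .
  have "complex_bracket (x, 0) (y, 0) \<noteq> 0" using nonabelian by (simp add: complex_bracket_def zero_prod_def)
  then obtain e h where eh: "(fst h, - snd h) = - h" "complex_bracket h e = complex_scale 2 e"
    "complex_bracket e (- (fst e, - snd e)) = h" "complexification.principal_nilpotent e" "e \<noteq> 0"
    using compact_conjugation.exists_principal_triple[OF B] by metis
  obtain a b where e: "e = (a, b)" by (cases e)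
  have h: "h = (0, bracket a b + bracket a b)"
    unfolding eh(3)[symmetric] e using bracket_swap[of b a]
    by (simp add: complex_bracket_def bracket_minus_left bracket_minus_right bracket_self)
  define c where "c = bracket a b + bracket a b"
  \<comment> \<open>This is \<open>- conj e\<close> for \<open>e = a + i b\<close>.\<close>
  define f where "f = (- a, b)"
  have "c = scale 2 (bracket a b)"
    using scale_left_distrib[of 1 1 "bracket a b"] by (simp add: c_def)
  then have ab: "bracket a b = scale (1/2) c" by simp
  have "- bracket c b = scale 2 a" "bracket c a = scale 2 b"
    using eh(2) by (simp_all add: h e c_def[symmetric] complex_bracket_def complex_scale_def)
  then have ca: "bracket c a = scale 2 b" and bc: "bracket b c = scale 2 a"
    using bracket_swap[of b c] by auto
  have "a \<noteq> 0" using eh(5) ca e by (auto simp: zero_prod_def)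
  note su2 = su2_triple_span[OF ab bc ca this]
  let ?S = "span {a, b, c}" and ?T = "complexification.span {e, h, f}"
  have "complexification.sl2_triple e h f"
    unfolding complexification.sl2_triple_def using eh(2,3) bc ca bracket_swap[of c b]
    by (simp add: e f_def h c_def[symmetric] complex_bracket_def complex_scale_def bracket_minus_right)
  moreover have "?S \<times> ?S = ?T"
  proof
    have "{e, h, f} \<subseteq> ?S \<times> ?S"
      by (auto simp: e f_def h c_def[symmetric] intro: span_base span_zero span_neg)
    then show "?T \<subseteq> ?S \<times> ?S"
      by (rule complexification.span_minimal) (rule csubspace_Times[OF subspace_span])
    have gen: "e \<in> ?T" "h \<in> ?T" "f \<in> ?T" by (auto intro: complexification.span_base)
    \<comment> \<open>Recovers the real generators: \<open>a = (e - f)/2\<close>,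
      \<open>b = - i/2 (e + f)\<close>, \<open>c = - i h\<close>.\<close>
    have "complex_scale (1/2) (e - f) \<in> ?T" "complex_scale (- \<i>/2) (e + f) \<in> ?T"
      "complex_scale (- \<i>) h \<in> ?T"
      by (intro complexification.span_scale complexification.span_diff complexification.span_add gen)+
    then have "(a, 0) \<in> ?T" "(b, 0) \<in> ?T" "(c, 0) \<in> ?T"
      by (simp_all add: e f_def h c_def[symmetric] complex_scale_def scale_left_distrib[symmetric]
          scale_right_distrib)
    then have "{a, b, c} \<subseteq> {x. (x, 0) \<in> ?T}" by simp
    then have "?S \<subseteq> {x. (x, 0) \<in> ?T}" by (rule span_minimal) (rule real_subspace_cspan)
    then show "?S \<times> ?S \<subseteq> ?T" using pair_mem_cspan by blast
  qed
  ultimately have "principal_three_dim_subalgebra ?S"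
    unfolding principal_three_dim_subalgebra_def complexification.principal_subalgebra_def
    using su2 eh(4) by blast
  then show ?thesis by blast
qed

end

theorem proposition2p6:
  fixes scale :: "real \<Rightarrow> 'a::ab_group_add \<Rightarrow> 'a"
    and bracket :: "'a \<Rightarrow> 'a \<Rightarrow> 'a"
  assumes "real_lie_algebra scale bracket"
    and "vector_space.finite_dim scale"
    and "lie_algebra.simple_subalgebra scale bracket UNIV"
    and "real_lie_algebra.compact_type scale bracket"
  shows "\<exists>S. real_lie_algebra.principal_three_dim_subalgebra scale bracket S"
proof -
  interpret real_lie_algebra scale bracket by (rule assms(1))
  obtain x y where "bracket x y \<noteq> 0" using assms(3) by (auto simp: simple_subalgebra_def)
  with assms(2,4) show ?thesis by (rule exists_principal_three_dim_subalgebra)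
qed

end
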